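(* For any $L_f>\mu_f>0$ and $\kappa_{\mathbf{A}},\kappa_{\mathbf{W}}\ge1$ there exist $L_f$-smooth $\mu_f$-strongly convex functions $\{f_i\}_{i=1}^n$, matrices $\mathbf{A}_i$ such that $\kappa_{\mathbf{A}}=L_{\mathbf{A}}/\mu_{\mathbf{A}}$, and a communication graph $\mathcal{G}$ with a corresponding gossip matrix $\mathbf{W}$ such that $\kappa_{\mathbf{W}}=\lambda_{\max}(\mathbf{W})/\lambda_{\min^+}(\mathbf{W})$, for which any first-order decentralized algorithm (in the sense of the context) on the problem $$\min_{x_1,\ldots,x_n}\ \sum_{i=1}^n f_i(x_i)\quad\text{s.t.}\quad\sum_{i=1}^n(\mathbf{A}_ix_i-b_i)=0$$ requires, to reach accuracy $\varepsilon$, at least $$N_f=\Omega\Big(\sqrt{\kappa_f}\log\frac1\varepsilon\Big)\ \text{gradient computations},$$ $$N_{\mathbf{A}}=\Omega\Big(\sqrt{\kappa_f}\sqrt{\kappa_{\mathbf{A}}}\log\frac1\varepsilon\Big)\ \text{multiplications by }\mathbf{A}\text{ and }\mathbf{A}^\top,$$ $$N_{\mathbf{W}}=\Omega\Big(\sqrt{\kappa_f}\sqrt{\kappa_{\mathbf{A}}}\sqrt{\kappa_{\mathbf{W}}}\log\frac1\varepsilon\Big)\ \text{communication rounds (multiplications by }\mathbf{W}).$$ Here $\kappa_f=L_f/\mu_f$.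
   Context: Constants: $L_{\mathbf{A}}\ge\mu_{\mathbf{A}}>0$ are constants satisfying $\max_i\sigma_{\max}^2(\mathbf{A}_i)\le L_{\mathbf{A}}$ and $\mu_{\mathbf{A}}\le\lambda_{\min^+}(\mathbf{S})$, $\mathbf{S}=\frac1n\sum_{i=1}^n\mathbf{A}_i\mathbf{A}_i^\top$, where $\sigma_{\max}$, $\lambda_{\max}$, $\lambda_{\min^+}$ denote the largest singular value, largest eigenvalue and smallest nonzero eigenvalue. $\mathbf{A}=\mathrm{diag}(\mathbf{A}_1,\dots,\mathbf{A}_n)$. A function $f$ is $L_f$-smooth and $\mu_f$-strongly convex if it is continuously differentiable and $\frac{\mu_f}{2}\|x_2-x_1\|^2\le f(x_2)-f(x_1)-\langle\nabla f(x_1),x_2-x_1\rangle\le\frac{L_f}{2}\|x_2-x_1\|^2$ for all $x_1,x_2$. Gossip matrix of a graph $\mathcal{G}=(\mathcal{V},\mathcal{E})$, $\mathcal{V}=\{1,\dots,n\}$: a symmetric positive semidefinite $W\in\mathbb{R}^{n\times n}$ with $W_{ij}\ne0$ iff $(i,j)\in\mathcal{E}$ or $i=j$, and $Wy=0$ iff $y_1=\dots=y_n$; $\mathbf{W}=W\otimes\mathbf{I}$ acts on $n$-tuples of vectors of the constraint space (same nonzero eigenvalues as $W$). Spaces: the local variable $x_i$ and the values $\mathbf{A}_ix_i$ lie in real Euclidean spaces $\mathbb{R}^{d_i}$, $\mathbb{R}^m$, or, as in infinite-dimensional hard instances, in the Hilbert space $\ell_2$ or finite products of it (with $\mathbf{A}_i$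 bounded linear operators). First-order decentralized algorithm: each node $i$ has at step $k$ two memory sets: a local memory $\mathcal{M}_i(k)$ (in the space of $x_i$) and a shared memory $\mathcal{H}_i(k)$ (in the space of $\mathbf{A}_ix_i$), with $\mathcal{M}_i(0)=\{0\}$, $\mathcal{H}_i(0)=\{0\}$. At each step the algorithm chooses one of three types of synchronized rounds, performed by all nodes $i\in\mathcal{V}$: 1. Gradient computation: $\mathcal{M}_i(k+1)=\mathrm{Span}\{x,\nabla f_i(x),\nabla f_i^*(x):x\in\mathcal{M}_i(k)\}$, $\mathcal{H}_i(k+1)=\mathcal{H}_i(k)$, where $f_i^*$ is the Fenchel conjugate of $f_i$. 2. Matrix multiplication: $\mathcal{M}_i(k+1)=\mathrm{Span}\{\mathbf{A}_i^\top b_i,\ \mathbf{A}_i^\top y:y\in\mathcal{H}_i(k)\}$, $\mathcal{H}_i(k+1)=\mathrm{Span}\{b_i,\ \mathbf{A}_ix:x\in\mathcal{M}_i(k)\}$. 3. Communication: $\mathcal{M}_i(k+1)=\mathcal{M}_i(k)$, $\mathcal{H}_i(k+1)=\mathrm{Span}\{\mathcal{H}_j(k):(i,j)\in\mathcal{E}\}$. $N_f$, $N_{\mathbf{A}}$, $N_{\mathbf{W}}$ are the numbers of rounds of types 1, 2, 3 respectively. The algorithm reaches accuracy $\varepsilon$ at step $k$ if its current point $x^k=(x_1^k,\dots,x_n^k)$, $x_i^k\in\mathcal{M}_i(k)$, satisfies $\|x^k-x^*\|^2\le\varepsilon$, where $x^*$ is the solution of the problem. Convention: $\Omega(\cdot)$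 suppresses numerical constants, and the dependence on problem-dependent additive constants inside the logarithm.
   Formalization: The constant in each Ω is a positive nondecreasing function of κ_f (one numerical constant for κ_f ≥ K, for each fixed K > 1), since no numerical constant works for all L_f > μ_f: as κ_f → 1 with κ_A = κ_W = 1, dual gradient descent beats any fixed multiple of log(1/ε). *)

theory Defs
  imports
    "HOL-Analysis.Analysis"
    "Jordan_Normal_Form.Spectral_Radius"
begin

section \<open>The real Hilbert space of square-summable sequences\<close>

typedef ell2 = "{x :: nat \<Rightarrow> real. summable (\<lambda>k. (x k)\<^sup>2)}"
  morphisms ell2_coord Abs_ell2
  by (rule exI[of _ "\<lambda>_. 0"]) simp

setup_lifting type_definition_ell2

lemma summable_mult_of_squares:
  fixes x y :: "nat \<Rightarrow> real"
  assumes "summable (\<lambda>k. (x k)\<^sup>2)" "summable (\<lambda>k. (y k)\<^sup>2)"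
  shows "summable (\<lambda>k. x k * y k)"
proof (rule summable_comparison_test'[where N = 0])
  show "summable (\<lambda>k. (x k)\<^sup>2 + (y k)\<^sup>2)"
    using assms by (rule summable_add)
  fix k
  have "0 \<le> (\<bar>x k\<bar> - \<bar>y k\<bar>)\<^sup>2" by simp
  then have "2 * (\<bar>x k\<bar> * \<bar>y k\<bar>) \<le> (x k)\<^sup>2 + (y k)\<^sup>2"
    by (simp add: power2_diff)
  moreover have "0 \<le> \<bar>x k\<bar> * \<bar>y k\<bar>" by simp
  ultimately show "norm (x k * y k) \<le> (x k)\<^sup>2 + (y k)\<^sup>2"
    unfolding real_norm_def abs_mult by linarith
qed

lemma summable_square_add:
  fixes x y :: "nat \<Rightarrow> real"
  assumes "summable (\<lambda>k. (x k)\<^sup>2)" "summable (\<lambda>k. (y k)\<^sup>2)"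
  shows "summable (\<lambda>k. (x k + y k)\<^sup>2)"
proof -
  have "summable (\<lambda>k. (x k)\<^sup>2 + (y k)\<^sup>2 + 2 * (x k * y k))"
    by (intro summable_add summable_mult assms summable_mult_of_squares)
  then show ?thesis by (simp add: power2_sum mult.assoc)
qed

instantiation ell2 :: real_vector
begin

lift_definition zero_ell2 :: ell2 is "\<lambda>_. 0" by simp

lift_definition plus_ell2 :: "ell2 \<Rightarrow> ell2 \<Rightarrow> ell2" is "\<lambda>x y k. x k + y k"
  by (rule summable_square_add)

lift_definition uminus_ell2 :: "ell2 \<Rightarrow> ell2" is "\<lambda>x k. - x k" by simp

lift_definition minus_ell2 :: "ell2 \<Rightarrow> ell2 \<Rightarrow> ell2" is "\<lambda>x y k. x k - y k"
  using summable_square_add[of _ "\<lambda>k. - _ k"] by simp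

lift_definition scaleR_ell2 :: "real \<Rightarrow> ell2 \<Rightarrow> ell2" is "\<lambda>r x k. r * x k"
  by (simp add: power_mult_distrib summable_mult)

instance
  by standard (transfer; simp add: algebra_simps)+

end

instantiation ell2 :: real_inner
begin

lift_definition inner_ell2 :: "ell2 \<Rightarrow> ell2 \<Rightarrow> real" is "\<lambda>x y. \<Sum>k. x k * y k" .

definition norm_ell2 :: "ell2 \<Rightarrow> real" where
  "norm_ell2 x = sqrt (inner x x)"

definition sgn_ell2 :: "ell2 \<Rightarrow> ell2" where
  "sgn_ell2 x = inverse (norm x) *\<^sub>R x"

definition dist_ell2 :: "ell2 \<Rightarrow> ell2 \<Rightarrow> real" where
  "dist_ell2 x y = norm (x - y)"

definition uniformity_ell2 :: "(ell2 \<times> ell2) filter" where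
  "uniformity_ell2 = (INF e\<in>{0<..}. principal {(x, y). dist x y < e})"

definition open_ell2 :: "ell2 set \<Rightarrow> bool" where
  "open_ell2 U = (\<forall>x\<in>U. eventually (\<lambda>(x', y). x' = x \<longrightarrow> y \<in> U) uniformity)"

instance
proof
  fix x y z :: ell2 and r :: real
  show "dist x y = norm (x - y)" by (rule dist_ell2_def)
  show "sgn x = x /\<^sub>R norm x" by (rule sgn_ell2_def)
  show "(uniformity :: (ell2 \<times> ell2) filter) = (INF e\<in>{0<..}. principal {(x, y). dist x y < e})"
    by (rule uniformity_ell2_def)
  show "open U = (\<forall>x\<in>U. \<forall>\<^sub>F (x', y) in uniformity. x' = x \<longrightarrow> y \<in> U)" for U :: "ell2 set"
    by (rule open_ell2_def)
  show "inner x y = inner y x"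
    by transfer (simp add: mult.commute)
  show "inner (x + y) z = inner x z + inner y z"
    by transfer (simp add: distrib_right suminf_add summable_mult_of_squares)
  show "inner (r *\<^sub>R x) y = r * inner x y"
    by transfer (simp add: mult.assoc suminf_mult summable_mult_of_squares)
  show "0 \<le> inner x x"
    by transfer (auto intro!: suminf_nonneg simp flip: power2_eq_square)
  show "inner x x = 0 \<longleftrightarrow> x = 0"
    by transfer (auto simp: suminf_eq_zero_iff fun_eq_iff simp flip: power2_eq_square)
  show "norm x = sqrt (inner x x)" by (rule norm_ell2_def)
qed

end

lemma norm_ell2_square: "(norm x)\<^sup>2 = (\<Sum>k. (ell2_coord x k)\<^sup>2)"
  unfolding dot_square_norm[symmetric] by transfer (simp add: power2_eq_square)

lemma sum_square_coord_le_norm: "(\<Sum>k<m. (ell2_coord x k)\<^sup>2) \<le> (norm x)\<^sup>2"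
  unfolding norm_ell2_square using ell2_coord[of x] by (intro sum_le_suminf) auto

lemma abs_coord_le_norm: "\<bar>ell2_coord x k\<bar> \<le> norm x"
proof -
  have "(ell2_coord x k)\<^sup>2 \<le> (\<Sum>j<Suc k. (ell2_coord x j)\<^sup>2)"
    by (simp add: sum_nonneg)
  also have "\<dots> \<le> (norm x)\<^sup>2" by (rule sum_square_coord_le_norm)
  finally show ?thesis by (metis abs_le_square_iff abs_norm_cancel)
qed

instance ell2 :: complete_space
proof
  fix X :: "nat \<Rightarrow> ell2"
  assume X: "Cauchy X"
  have "Cauchy (\<lambda>n. ell2_coord (X n) k)" for k
  proof (rule CauchyI)
    fix e :: real assume "0 < e"
    with X obtain M where M: "\<forall>m\<ge>M. \<forall>n\<ge>M. norm (X m - X n) < e"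
      by (meson CauchyD)
    have "norm (ell2_coord (X m) k - ell2_coord (X n) k) < e" if "m \<ge> M" "n \<ge> M" for m n
      using abs_coord_le_norm[of "X m - X n" k] M that
      by (fastforce simp: minus_ell2.rep_eq)
    then show "\<exists>M. \<forall>m\<ge>M. \<forall>n\<ge>M. norm (ell2_coord (X m) k - ell2_coord (X n) k) < e"
      by blast
  qed
  then have "\<forall>k. \<exists>l. (\<lambda>n. ell2_coord (X n) k) \<longlonglongrightarrow> l"
    by (simp add: Cauchy_convergent_iff convergent_def)
  then obtain l where l: "\<And>k. (\<lambda>n. ell2_coord (X n) k) \<longlonglongrightarrow> l k" by metis
  have partial: "(\<Sum>k<j. (ell2_coord (X m) k - l k)\<^sup>2) \<le> e\<^sup>2"
    if M: "\<forall>m\<ge>M. \<forall>n\<ge>M. norm (X m - X n) < e" and "m \<ge> M" for M m j e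
  proof (rule LIMSEQ_le_const2)
    show "(\<lambda>n. \<Sum>k<j. (ell2_coord (X m) k - ell2_coord (X n) k)\<^sup>2)
            \<longlonglongrightarrow> (\<Sum>k<j. (ell2_coord (X m) k - l k)\<^sup>2)"
      by (intro tendsto_intros l)
    have "(\<Sum>k<j. (ell2_coord (X m) k - ell2_coord (X n) k)\<^sup>2) \<le> e\<^sup>2" if "n \<ge> M" for n
    proof -
      have "(\<Sum>k<j. (ell2_coord (X m) k - ell2_coord (X n) k)\<^sup>2) \<le> (norm (X m - X n))\<^sup>2"
        using sum_square_coord_le_norm[of "X m - X n" j] by (simp add: minus_ell2.rep_eq)
      also have "\<dots> \<le> e\<^sup>2"
        using M \<open>m \<ge> M\<close> that by (intro power_mono) (auto intro: less_imp_le)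
      finally show ?thesis .
    qed
    then show "\<exists>N. \<forall>n\<ge>N. (\<Sum>k<j. (ell2_coord (X m) k - ell2_coord (X n) k)\<^sup>2) \<le> e\<^sup>2"
      by blast
  qed
  have summ: "summable (\<lambda>k. (ell2_coord (X m) k - l k)\<^sup>2)"
    if "\<forall>m\<ge>M. \<forall>n\<ge>M. norm (X m - X n) < e" and "m \<ge> M" for M m e
    by (rule bounded_imp_summable[where B = "e\<^sup>2"])
       (use partial[OF that, of "Suc _"] in \<open>auto simp: lessThan_Suc_atMost\<close>)
  obtain M0 where M0: "\<forall>m\<ge>M0. \<forall>n\<ge>M0. norm (X m - X n) < 1"
    using CauchyD[OF X, of 1] by auto
  have "summable (\<lambda>k. (ell2_coord (X M0) k + - (ell2_coord (X M0) k - l k))\<^sup>2)"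
    by (rule summable_square_add)
       (use ell2_coord[of "X M0"] summ[OF M0 order_refl] in \<open>simp_all add: power2_commute\<close>)
  then have "summable (\<lambda>k. (l k)\<^sup>2)" by simp
  then have L: "ell2_coord (Abs_ell2 l) = l" by (simp add: Abs_ell2_inverse)
  have "X \<longlonglongrightarrow> Abs_ell2 l"
  proof (rule metric_LIMSEQ_I)
    fix e :: real assume "0 < e"
    then have "0 < e / 2" by simp
    with X obtain M where M: "\<forall>m\<ge>M. \<forall>n\<ge>M. norm (X m - X n) < e / 2"
      by (meson CauchyD)
    have "dist (X m) (Abs_ell2 l) < e" if "m \<ge> M" for m
    proof -
      have "(norm (X m - Abs_ell2 l))\<^sup>2 = (\<Sum>k. (ell2_coord (X m) k - l k)\<^sup>2)"
        by (simp add: norm_ell2_square minus_ell2.rep_eq L)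
      also have "\<dots> \<le> (e / 2)\<^sup>2"
        using partial[OF M that] by (intro suminf_le_const summ[OF M that])
      finally have "norm (X m - Abs_ell2 l) \<le> e / 2"
        using \<open>0 < e / 2\<close> by (meson less_imp_le power2_le_imp_le)
      then show ?thesis using \<open>0 < e\<close> by (simp add: dist_norm)
    qed
    then show "\<exists>M. \<forall>m\<ge>M. dist (X m) (Abs_ell2 l) < e" by blast
  qed
  then show "convergent X" by (auto simp: convergent_def)
qed

instance ell2 :: banach ..


section \<open>Functions\<close>

definition grad :: "('a::real_inner \<Rightarrow> real) \<Rightarrow> 'a \<Rightarrow> 'a" where
  "grad f x = (THE D. GDERIV f x :> D)"

definition smooth_strongly_convex :: "real \<Rightarrow> real \<Rightarrow> ('a::real_inner \<Rightarrow> real) \<Rightarrow> bool" where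
  "smooth_strongly_convex L \<mu> f \<longleftrightarrow>
     (\<forall>x. GDERIV f x :> grad f x) \<and> continuous_on UNIV (grad f) \<and>
     (\<forall>x1 x2. \<mu> / 2 * (norm (x2 - x1))\<^sup>2 \<le> f x2 - f x1 - inner (grad f x1) (x2 - x1) \<and>
              f x2 - f x1 - inner (grad f x1) (x2 - x1) \<le> L / 2 * (norm (x2 - x1))\<^sup>2)"

text \<open>The supremum below is taken in the reals; it is finite for every strongly convex function.\<close>

definition fenchel_conjugate :: "('a::real_inner \<Rightarrow> real) \<Rightarrow> 'a \<Rightarrow> real" where
  "fenchel_conjugate f y = (SUP x. inner y x - f x)"


section \<open>Spectral quantities\<close>

text \<open>
  On an infinite-dimensional space the eigenvalues of a self-adjoint operator have to be replaced by
  its spectrum. The real spectrum suffices, since it is only used for self-adjoint operators. In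
  finite dimension it is the set of real eigenvalues, and the infimum and the supremum below are a
  minimum and a maximum. If \<open>0\<close> is not isolated in the spectrum then \<open>lambda_min_pos T\<close> is \<open>0\<close> for
  positive semidefinite \<open>T\<close>.
\<close>

definition op_spectrum :: "('a::real_normed_vector \<Rightarrow> 'a) \<Rightarrow> real set" where
  "op_spectrum T = {r. \<not> (\<exists>R. bounded_linear R \<and>
      (\<forall>x. R (T x - r *\<^sub>R x) = x) \<and> (\<forall>x. T (R x) - r *\<^sub>R R x = x))}"

definition lambda_min_pos :: "('a::real_normed_vector \<Rightarrow> 'a) \<Rightarrow> real" where
  "lambda_min_pos T = Inf (op_spectrum T - {0})"

definition sigma_max :: "('a::real_inner \<Rightarrow> 'b::real_inner) \<Rightarrow> real" where
  "sigma_max A = sqrt (Sup (op_spectrum (adjoint A \<circ> A)))"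

definition gram_mean :: "nat \<Rightarrow> (nat \<Rightarrow> 'a::real_inner \<Rightarrow> 'b::real_inner) \<Rightarrow> 'b \<Rightarrow> 'b" where
  "gram_mean n A y = (1 / real n) *\<^sub>R (\<Sum>i<n. A i (adjoint (A i) y))"

text \<open>
  \<open>L\<close> and \<open>\<mu>\<close> are only required to bound the extremal spectral values of the constraint operators.
  The condition \<open>gram_mean n A \<noteq> (\<lambda>_. 0)\<close> makes \<open>lambda_min_pos\<close> the infimum of a nonempty set.
\<close>

definition constraint_constants ::
    "nat \<Rightarrow> (nat \<Rightarrow> 'a::real_inner \<Rightarrow> 'b::real_inner) \<Rightarrow> real \<Rightarrow> real \<Rightarrow> bool" where
  "constraint_constants n A L \<mu> \<longleftrightarrow>
     0 < \<mu> \<and> \<mu> \<le> L \<and> gram_mean n A \<noteq> (\<lambda>_. 0) \<and>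
     (MAX i\<in>{..<n}. (sigma_max (A i))\<^sup>2) \<le> L \<and> \<mu> \<le> lambda_min_pos (gram_mean n A)"


section \<open>Communication graphs and gossip matrices\<close>

text \<open>The nodes are numbered from \<open>0\<close> to \<open>n - 1\<close>.\<close>

definition simple_graph :: "nat \<Rightarrow> (nat \<times> nat) set \<Rightarrow> bool" where
  "simple_graph n E \<longleftrightarrow> E \<subseteq> {..<n} \<times> {..<n} \<and> sym E \<and> irrefl E"

definition gossip_matrix :: "nat \<Rightarrow> (nat \<times> nat) set \<Rightarrow> real mat \<Rightarrow> bool" where
  "gossip_matrix n E W \<longleftrightarrow>
     W \<in> carrier_mat n n \<and> transpose_mat W = W \<and>
     (\<forall>y \<in> carrier_vec n. 0 \<le> scalar_prod y (W *\<^sub>v y)) \<and>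
     (\<forall>i<n. \<forall>j<n. W $$ (i, j) \<noteq> 0 \<longleftrightarrow> (i, j) \<in> E \<or> i = j) \<and>
     (\<forall>y \<in> carrier_vec n. W *\<^sub>v y = 0\<^sub>v n \<longleftrightarrow> (\<forall>i<n. \<forall>j<n. vec_index y i = vec_index y j))"

text \<open>
  The operator induced by \<open>W\<close> on tuples of vectors of the constraint space has the same nonzero
  eigenvalues as \<open>W\<close>, so its condition number is that of \<open>W\<close>.
\<close>

definition gossip_condition_number :: "real mat \<Rightarrow> real" where
  "gossip_condition_number W = Max (spectrum W) / Min (spectrum W - {0})"


section \<open>The problem and the algorithms\<close>

definition feasible ::
    "nat \<Rightarrow> (nat \<Rightarrow> 'a::real_inner \<Rightarrow> 'b::real_inner) \<Rightarrow> (nat \<Rightarrow> 'b) \<Rightarrow> (nat \<Rightarrow> 'a) \<Rightarrow> bool" where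
  "feasible n A b x \<longleftrightarrow> (\<Sum>i<n. A i (x i) - b i) = 0"

definition is_solution ::
    "nat \<Rightarrow> (nat \<Rightarrow> 'a::real_inner \<Rightarrow> real) \<Rightarrow> (nat \<Rightarrow> 'a \<Rightarrow> 'b::real_inner) \<Rightarrow> (nat \<Rightarrow> 'b) \<Rightarrow>
     (nat \<Rightarrow> 'a) \<Rightarrow> bool" where
  "is_solution n f A b x \<longleftrightarrow>
     feasible n A b x \<and> (\<forall>y. feasible n A b y \<longrightarrow> (\<Sum>i<n. f i (x i)) \<le> (\<Sum>i<n. f i (y i)))"

datatype round = Gradient_Round | Multiplication_Round | Communication_Round

type_synonym ('a, 'b) memory = "(nat \<Rightarrow> 'a set) \<times> (nat \<Rightarrow> 'b set)"

text \<open>The first component is the local memory of each node, the second one its shared memory.\<close>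

fun perform_round ::
    "(nat \<Rightarrow> 'a::real_inner \<Rightarrow> real) \<Rightarrow> (nat \<Rightarrow> 'a \<Rightarrow> 'b::real_inner) \<Rightarrow> (nat \<Rightarrow> 'b) \<Rightarrow>
     (nat \<times> nat) set \<Rightarrow> round \<Rightarrow> ('a, 'b) memory \<Rightarrow> ('a, 'b) memory" where
  "perform_round f A b E Gradient_Round (M, H) =
     (\<lambda>i. span (\<Union>x\<in>M i. {x, grad (f i) x, grad (fenchel_conjugate (f i)) x}), H)"
| "perform_round f A b E Multiplication_Round (M, H) =
     (\<lambda>i. span ({adjoint (A i) (b i)} \<union> {adjoint (A i) y | y. y \<in> H i}),
      \<lambda>i. span ({b i} \<union> {A i x | x. x \<in> M i}))"
| "perform_round f A b E Communication_Round (M, H) =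
     (M, \<lambda>i. span (\<Union>j\<in>{j. (i, j) \<in> E}. H j))"

text \<open>
  An algorithm is characterised by the sequence of rounds it performs and by the points it selects
  from its local memories; \<open>memory_after f A b E rs\<close> is the memory at step \<open>length rs\<close> when the
  rounds \<open>rs\<close> have been performed in this order.
\<close>

definition memory_after ::
    "(nat \<Rightarrow> 'a::real_inner \<Rightarrow> real) \<Rightarrow> (nat \<Rightarrow> 'a \<Rightarrow> 'b::real_inner) \<Rightarrow> (nat \<Rightarrow> 'b) \<Rightarrow>
     (nat \<times> nat) set \<Rightarrow> round list \<Rightarrow> ('a, 'b) memory" where
  "memory_after f A b E rs = fold (perform_round f A b E) rs (\<lambda>_. {0}, \<lambda>_. {0})"

definition reaches_accuracy ::
    "nat \<Rightarrow> (nat \<Rightarrow> 'a::real_inner \<Rightarrow> real) \<Rightarrow> (nat \<Rightarrow> 'a \<Rightarrow> 'b::real_inner) \<Rightarrow> (nat \<Rightarrow> 'b) \<Rightarrow>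
     (nat \<times> nat) set \<Rightarrow> (nat \<Rightarrow> 'a) \<Rightarrow> real \<Rightarrow> round list \<Rightarrow> (nat \<Rightarrow> 'a) \<Rightarrow> bool" where
  "reaches_accuracy n f A b E xopt \<epsilon> rs x \<longleftrightarrow>
     (\<forall>i<n. x i \<in> fst (memory_after f A b E rs) i) \<and> (\<Sum>i<n. (norm (x i - xopt i))\<^sup>2) \<le> \<epsilon>"

end

theory Submission
  imports Defs
begin

text \<open>
  The hard instance is a chain of coordinates that has to be explored from its first position on. All
  \<open>f\<^sub>i\<close> are quadratic forms and all \<open>A\<^sub>i\<close> are self-adjoint; both act by a large or a small scalar on the
  antisymmetric and on the symmetric parts of pairs of coordinates. The pairs are \<open>{0, 1}, {2, 3}, \<dots>\<close> at the
  nodes of a left group, \<open>{1, 2}, {3, 4}, \<dots>\<close> at those of a right group, and trivial at the nodes between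
  them. The dual problem has a single variable \<open>z\<close>, shared by all nodes, and the optimality condition
  \<open>\<Sum>\<^sub>i A\<^sub>i Q\<^sub>i\<inverse> A\<^sub>i z = \<Sum>\<^sub>i b\<^sub>i\<close>, where \<open>Q\<^sub>i\<close> is the Hessian of \<open>f\<^sub>i\<close>. Here the two systems of pairs add up
  to a tridiagonal operator on the sequence space, and with right-hand sides in the first position the
  solution is a geometric sequence \<open>z\<^sub>j = q\<^sup>j\<close> (\<open>dual_optimality\<close>, \<open>is_solution_xopt\<close>). Its rate satisfies
  \<open>- ln q \<le> c / \<surd>\<kappa>\<close>, where \<open>\<kappa>\<close> is the condition number of the outer summands and \<open>c\<close> only depends on
  \<open>\<kappa>\<^sub>f\<close> (\<open>decay\<close>), so an algorithm
  that has explored \<open>p\<close> positions has an error of at least a constant times \<open>q\<^sup>2\<^sup>p\<close>, and accuracy \<open>\<epsilon>\<close> needs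
  \<open>p\<close> of the order of \<open>\<surd>\<kappa> ln (1 / \<epsilon>)\<close> (\<open>error_lower_bound\<close>, \<open>rounds_lower_bound\<close>).

  No node can pass two consecutive links of the chain on its own, so between them a vector has to travel
  from one group to the other. If \<open>A\<^sub>i\<close> acts on the pairs as well as \<open>f\<^sub>i\<close>, then \<open>\<kappa> = \<kappa>\<^sub>f \<kappa>\<^sub>A\<close>. Each link costs a
  multiplication, since vectors are only exchanged through the shared memories, and a number of communication
  rounds proportional to the number of nodes (\<open>multiplication_frontier\<close>, \<open>communication_frontier\<close>). Such a chain
  can however be explored by multiplications alone. The bound on gradient computations comes from a second
  chain, a direct summand of the same instance, on which \<open>A\<^sub>i\<close> is the identity. There \<open>\<kappa> = \<kappa>\<^sub>f\<close>, and
  only the gradients of \<open>f\<^sub>i\<close> and of its conjugate move along the links (\<open>gradient_frontier\<close>). All three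
  bounds are instances of one invariant on the supports of the vectors in the memories (\<open>memory_confined\<close>).

  The operators satisfy \<open>I \<le> A\<^sub>i A\<^sub>i\<^sup>T \<le> \<kappa>\<^sub>A I\<close>, hence so does their mean; Lax--Milgram turns this into a
  statement on spectra (\<open>constraint_constants_A\<close>). It remains to find gossip matrices of any given condition
  number \<open>\<kappa>\<^sub>W\<close> on graphs of diameter of the order of \<open>\<surd>\<kappa>\<^sub>W\<close> (\<open>exists_gossip_matrix\<close>): a quadratic polynomial in the
  Laplacian of a weighted path whose spectral gap is explicit, or, for small \<open>\<kappa>\<^sub>W\<close>, a matrix on three nodes.
\<close>


section \<open>Coercive operators and spectra\<close>

text \<open>
  The Lax--Milgram theorem: for small \<open>t > 0\<close> the map \<open>x \<mapsto> x - t (T x - y)\<close> is a contraction,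
  because \<open>\<parallel>x - t T x\<parallel>\<^sup>2 \<le> (1 - 2 t c + t\<^sup>2 K\<^sup>2) \<parallel>x\<parallel>\<^sup>2\<close>, and its fixed point solves \<open>T x = y\<close>.
\<close>

lemma coercive_imp_surj:
  fixes T :: "'a::{real_inner,complete_space} \<Rightarrow> 'a"
  assumes T: "bounded_linear T" and c: "0 < c" and co: "\<And>x. c * (norm x)\<^sup>2 \<le> inner (T x) x"
  shows "\<exists>x. T x = y"
proof -
  interpret T: bounded_linear T by (rule T)
  obtain K where K: "K > 0" "\<And>x. norm (T x) \<le> norm x * K"
    using T.pos_bounded by blast
  define t where "t = c / (K\<^sup>2 + c\<^sup>2)"
  have den: "K\<^sup>2 + c\<^sup>2 > 0" using K(1) by (simp add: add_pos_nonneg)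
  have t: "t > 0" unfolding t_def using c den by simp
  \<comment> \<open>an upper bound on the square of the contraction factor\<close>
  define r where "r = 1 - 2 * t * c + t\<^sup>2 * (K\<^sup>2 + c\<^sup>2)"
  have r1: "r = 1 - t * c"
  proof -
    have "t * (K\<^sup>2 + c\<^sup>2) = c" unfolding t_def using den by simp
    then have "t\<^sup>2 * (K\<^sup>2 + c\<^sup>2) = t * c" by (simp only: power2_eq_square[of t] mult.assoc)
    then show ?thesis unfolding r_def by simp
  qed
  have tc: "0 < t * c" "t * c \<le> 1"
    using t c den by (simp_all add: t_def field_simps power2_eq_square)
  define g where "g x = x - t *\<^sub>R (T x - y)" for x
  have expand: "(norm (a - t *\<^sub>R d))\<^sup>2 = (norm a)\<^sup>2 - 2 * t * inner d a + t\<^sup>2 * (norm d)\<^sup>2" for a d :: 'a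
    unfolding power2_norm_eq_inner
    by (simp add: inner_simps inner_commute[of a d] power2_eq_square[of t] algebra_simps)
  have "dist (g u) (g v) \<le> sqrt r * dist u v" for u v
  proof -
    have "(norm (g u - g v))\<^sup>2 = (norm ((u - v) - t *\<^sub>R T (u - v)))\<^sup>2"
      by (simp add: g_def T.diff algebra_simps)
    also have "\<dots> = (norm (u - v))\<^sup>2 - 2 * t * inner (T (u - v)) (u - v) + t\<^sup>2 * (norm (T (u - v)))\<^sup>2"
      by (rule expand)
    also have "\<dots> \<le> (norm (u - v))\<^sup>2 - 2 * t * (c * (norm (u - v))\<^sup>2) + t\<^sup>2 * (norm (u - v) * K)\<^sup>2"
    proof -
      have "2 * t * (c * (norm (u - v))\<^sup>2) \<le> 2 * t * inner (T (u - v)) (u - v)"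
        using co[of "u - v"] t by (intro mult_left_mono) auto
      moreover have "t\<^sup>2 * (norm (T (u - v)))\<^sup>2 \<le> t\<^sup>2 * (norm (u - v) * K)\<^sup>2"
        using K(2)[of "u - v"] by (intro mult_left_mono power_mono) auto
      ultimately show ?thesis by linarith
    qed
    also have "\<dots> = (1 - 2 * t * c + t\<^sup>2 * K\<^sup>2) * (norm (u - v))\<^sup>2"
      by (simp add: algebra_simps power_mult_distrib)
    also have "\<dots> \<le> r * (norm (u - v))\<^sup>2"
      unfolding r_def by (intro mult_right_mono) (auto simp: algebra_simps)
    finally have "norm (g u - g v) \<le> sqrt (r * (norm (u - v))\<^sup>2)" by (rule real_le_rsqrt)
    then show ?thesis by (simp add: dist_norm real_sqrt_mult)
  qed
  moreover have "0 \<le> sqrt r" "sqrt r < 1" using r1 tc by auto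
  ultimately obtain x where "g x = x"
    using banach_fix_type[of "sqrt r" g] by blast
  then have "T x = y" using t by (simp add: g_def)
  then show ?thesis ..
qed

lemma coercive_imp_not_in_spectrum:
  fixes T :: "'a::{real_inner,complete_space} \<Rightarrow> 'a"
  assumes T: "bounded_linear T" and c: "r < c" and co: "\<And>x. c * (norm x)\<^sup>2 \<le> inner (T x) x"
  shows "r \<notin> op_spectrum T"
proof -
  define B where "B x = T x - r *\<^sub>R x" for x
  have B: "bounded_linear B"
    unfolding B_def by (intro bounded_linear_sub T bounded_linear_scaleR_right)
  interpret B: bounded_linear B by (rule B)
  have co': "(c - r) * (norm x)\<^sup>2 \<le> inner (B x) x" for x
    using co[of x] by (simp add: B_def inner_diff_left algebra_simps dot_square_norm)
  have lower: "(c - r) * norm x \<le> norm (B x)" for x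
  proof (cases "x = 0")
    case False
    have "(c - r) * (norm x)\<^sup>2 \<le> norm (B x) * norm x"
      using co'[of x] norm_cauchy_schwarz[of "B x" x] by linarith
    then show ?thesis using False by (simp add: power2_eq_square)
  qed (simp add: B.zero)
  have inj: "x = y" if "B x = B y" for x y
  proof -
    have "(c - r) * norm (x - y) \<le> 0" using lower[of "x - y"] that by (simp add: B.diff)
    moreover have "0 \<le> (c - r) * norm (x - y)" using c by simp
    ultimately have "(c - r) * norm (x - y) = 0" by linarith
    then show ?thesis using c by simp
  qed
  have "\<exists>x. B x = y" for y
    by (rule coercive_imp_surj[OF B _ co']) (use c in auto)
  then obtain R where R: "\<And>y. B (R y) = y" by metis
  have RB: "R (B x) = x" for x by (rule inj) (rule R)
  have "bounded_linear R"
  proof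
    show "R (x + y) = R x + R y" for x y by (rule inj) (simp add: R B.add)
    show "R (a *\<^sub>R x) = a *\<^sub>R R x" for a x by (rule inj) (simp add: R B.scaleR)
    have "norm (R x) \<le> norm x * (1 / (c - r))" for x
      using lower[of "R x"] c by (simp add: R field_simps)
    then show "\<exists>K. \<forall>x. norm (R x) \<le> norm x * K" by blast
  qed
  with R RB show ?thesis unfolding op_spectrum_def B_def by blast
qed

lemma eigenvalue_in_op_spectrum:
  assumes "T e = r *\<^sub>R e" "e \<noteq> 0"
  shows "r \<in> op_spectrum T"
proof -
  have "e = 0" if "bounded_linear R" "\<forall>x. R (T x - r *\<^sub>R x) = x" for R
  proof -
    have "R (T e - r *\<^sub>R e) = e" using that by blast
    then show "e = 0" using assms(1) linear_0[OF bounded_linear.linear[OF that(1)]] by simp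
  qed
  then show ?thesis using assms(2) unfolding op_spectrum_def by blast
qed


section \<open>Operators with two spectral values\<close>

text \<open>
  All operators of the hard instance act by one scalar on the antisymmetric part and by
  another one on the symmetric part of a self-adjoint isometric involution.
\<close>

definition reflection :: "('a::real_inner \<Rightarrow> 'a) \<Rightarrow> bool" where
  "reflection R \<longleftrightarrow> linear R \<and> (\<forall>x. R (R x) = x) \<and> (\<forall>x. norm (R x) = norm x)"

definition split_op :: "real \<Rightarrow> real \<Rightarrow> ('a::real_inner \<Rightarrow> 'a) \<Rightarrow> 'a \<Rightarrow> 'a" where
  "split_op a c R x = (a / 2) *\<^sub>R (x - R x) + (c / 2) *\<^sub>R (x + R x)"

context
  fixes R :: "'a::real_inner \<Rightarrow> 'a"
  assumes R: "reflection R"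
begin

lemma reflection_simps:
  "R (x + y) = R x + R y" "R (x - y) = R x - R y" "R (a *\<^sub>R x) = a *\<^sub>R R x" "R (R x) = x" "R 0 = 0"
  "norm (R x) = norm x"
  using R unfolding reflection_def by (auto simp: linear_add linear_diff linear_scale linear_0)

text \<open>By polarization, an isometric involution is self-adjoint.\<close>

lemma reflection_inner: "inner (R x) y = inner x (R y)"
proof -
  have "(norm (R x + R (R y)))\<^sup>2 = (norm (x + R y))\<^sup>2"
    by (metis reflection_simps(1,6))
  then show ?thesis
    by (simp add: power2_norm_eq_inner[symmetric] dot_norm reflection_simps)
qed

lemma bounded_linear_split_op: "bounded_linear (split_op a c R)"
proof -
  have "bounded_linear R"
    by (rule bounded_linear_intro[where K = 1]) (simp_all add: reflection_simps)
  then show ?thesis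
    unfolding split_op_def
    by (intro bounded_linear_add bounded_linear_sub bounded_linear_ident
        bounded_linear_compose[OF bounded_linear_scaleR_right])
qed

lemma split_op_inner: "inner (split_op a c R x) y = inner x (split_op a c R y)"
  by (simp add: split_op_def inner_simps reflection_inner)

lemma adjoint_split_op: "adjoint (split_op a c R) = split_op a c R"
  by (rule adjoint_unique) (simp add: split_op_inner)

lemma split_op_compose: "split_op a c R (split_op a' c' R x) = split_op (a * a') (c * c') R x"
  by (simp add: split_op_def reflection_simps algebra_simps)
     (simp add: scaleR_add_left[symmetric] field_simps)

lemma split_op_one: "split_op 1 1 R x = x"
  by (simp add: split_op_def algebra_simps scaleR_add_left[symmetric])

lemma split_op_quadratic:
  "inner (split_op a c R x) x = a * (norm ((1/2) *\<^sub>R (x - R x)))\<^sup>2 + c * (norm ((1/2) *\<^sub>R (x + R x)))\<^sup>2"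
proof -
  have "inner (R x) (R x) = inner x x"
    by (simp add: reflection_inner reflection_simps)
  then show ?thesis
    unfolding split_op_def
    by (simp add: power2_norm_eq_inner inner_simps inner_commute[of x "R x"] field_simps)
qed

lemma split_op_bounds:
  shows split_op_lower: "l \<le> a \<Longrightarrow> l \<le> c \<Longrightarrow> l * (norm x)\<^sup>2 \<le> inner (split_op a c R x) x"
    and split_op_upper: "a \<le> u \<Longrightarrow> c \<le> u \<Longrightarrow> inner (split_op a c R x) x \<le> u * (norm x)\<^sup>2"
proof -
  have "(norm x)\<^sup>2 = inner (split_op 1 1 R x) x" by (simp add: split_op_one power2_norm_eq_inner)
  then have n: "(norm x)\<^sup>2 = (norm ((1/2) *\<^sub>R (x - R x)))\<^sup>2 + (norm ((1/2) *\<^sub>R (x + R x)))\<^sup>2"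
    unfolding split_op_quadratic by simp
  show "l * (norm x)\<^sup>2 \<le> inner (split_op a c R x) x" if "l \<le> a" "l \<le> c"
    unfolding split_op_quadratic n distrib_left using that
    by (intro add_mono mult_right_mono) auto
  show "inner (split_op a c R x) x \<le> u * (norm x)\<^sup>2" if "a \<le> u" "c \<le> u"
    unfolding split_op_quadratic n distrib_left using that
    by (intro add_mono mult_right_mono) auto
qed

lemma op_spectrum_split_op: "op_spectrum (split_op a c R) \<subseteq> {a, c}"
proof
  fix r assume r: "r \<in> op_spectrum (split_op a c R)"
  show "r \<in> {a, c}"
  proof (rule ccontr)
    assume "r \<notin> {a, c}"
    then have ne: "a - r \<noteq> 0" "c - r \<noteq> 0" by auto
    let ?S = "split_op (1 / (a - r)) (1 / (c - r)) R"
    have shift: "split_op a c R x - r *\<^sub>R x = split_op (a - r) (c - r) R x" for x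
      by (simp add: split_op_def algebra_simps diff_divide_distrib)
         (simp add: scaleR_add_left[symmetric])
    have "bounded_linear ?S" by (rule bounded_linear_split_op)
    moreover have "?S (split_op a c R x - r *\<^sub>R x) = x" "split_op a c R (?S x) - r *\<^sub>R ?S x = x" for x
      unfolding shift using ne by (simp_all add: split_op_compose split_op_one)
    ultimately show False using r unfolding op_spectrum_def by blast
  qed
qed

end


section \<open>Quadratic functions\<close>

definition quadratic :: "('a::real_inner \<Rightarrow> 'a) \<Rightarrow> 'a \<Rightarrow> real" where
  "quadratic Q x = inner (Q x) x / 2"

lemma grad_unique: "GDERIV f x :> D \<Longrightarrow> grad f x = D"
  unfolding grad_def gderiv_def
proof (rule the_equality)
  fix D' assume "FDERIV f x :> (\<lambda>h. inner h D)" "FDERIV f x :> (\<lambda>h. inner h D')"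
  then have "(\<lambda>h. inner h D) = (\<lambda>h. inner h D')" by (rule has_derivative_unique)
  then have "inner (D' - D) D = inner (D' - D) D'" by meson
  then have "inner (D' - D) (D' - D) = 0" by (simp add: inner_diff_right)
  then show "D' = D" by simp
qed

context
  fixes Q :: "'a::real_inner \<Rightarrow> 'a"
  assumes Q: "bounded_linear Q" and sym: "\<And>x y. inner (Q x) y = inner x (Q y)"
begin

lemma quadratic_GDERIV: "GDERIV (quadratic Q) x :> Q x"
  unfolding gderiv_def quadratic_def
proof (rule has_derivative_eq_rhs)
  show "((\<lambda>x. inner (Q x) x / 2) has_derivative (\<lambda>h. (inner (Q x) h + inner (Q h) x) / 2)) (at x)"
    by (auto intro!: derivative_eq_intros bounded_linear_imp_has_derivative[OF Q])
  show "(\<lambda>h. (inner (Q x) h + inner (Q h) x) / 2) = (\<lambda>h. inner h (Q x))"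
  proof
    show "(inner (Q x) h + inner (Q h) x) / 2 = inner h (Q x)" for h
      using sym[of h x] by (simp add: inner_commute)
  qed
qed

lemma grad_quadratic: "grad (quadratic Q) = Q"
  using grad_unique[OF quadratic_GDERIV] by blast

lemma quadratic_expand: "quadratic Q y - quadratic Q x - inner (Q x) (y - x) = quadratic Q (y - x)"
proof -
  interpret Q: bounded_linear Q by (rule Q)
  show ?thesis
    by (simp add: quadratic_def Q.diff inner_simps sym inner_commute[of x "Q y"] field_simps)
qed

lemma smooth_strongly_convex_quadratic:
  assumes "\<And>x. \<mu> * (norm x)\<^sup>2 \<le> inner (Q x) x" "\<And>x. inner (Q x) x \<le> L * (norm x)\<^sup>2"
  shows "smooth_strongly_convex L \<mu> (quadratic Q)"
  unfolding smooth_strongly_convex_def grad_quadratic quadratic_expand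
  using quadratic_GDERIV linear_continuous_on[OF Q] assms by (auto simp: quadratic_def)

text \<open>
  Completing the square, \<open>\<langle>y, x\<rangle> - q(x) = q\<^sup>*(y) - q(x - Q\<inverse> y)\<close>, so the supremum is attained at
  \<open>x = Q\<inverse> y\<close>.
\<close>

lemma fenchel_conjugate_quadratic:
  assumes inv: "\<And>y. Q (S y) = y" and pos: "\<And>x. 0 \<le> inner (Q x) x"
  shows "fenchel_conjugate (quadratic Q) = quadratic S"
proof
  fix y
  have eq: "inner y x - quadratic Q x = quadratic S y - quadratic Q (x - S y)" for x
    using quadratic_expand[of x "S y"]
    by (simp add: inv quadratic_def inner_diff_right inner_commute)
  show "fenchel_conjugate (quadratic Q) y = quadratic S y"
    unfolding fenchel_conjugate_def
  proof (rule cSup_eq_maximum)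
    show "quadratic S y \<in> range (\<lambda>x. inner y x - quadratic Q x)"
      unfolding eq using linear_0[OF bounded_linear.linear[OF Q]]
      by (intro image_eqI[where x = "S y"]) (auto simp: quadratic_def)
    show "z \<le> quadratic S y" if "z \<in> range (\<lambda>x. inner y x - quadratic Q x)" for z
      using that pos unfolding eq by (auto simp: quadratic_def)
  qed
qed

end


section \<open>Coordinate permutations and supports in the sequence space\<close>

lemma ell2_eqI: "(\<And>k. ell2_coord x k = ell2_coord y k) \<Longrightarrow> x = y"
  by (simp add: ell2_coord_inject[symmetric] fun_eq_iff)

lemmas coord_simps = zero_ell2.rep_eq plus_ell2.rep_eq minus_ell2.rep_eq scaleR_ell2.rep_eq

lemma coord_sum: "ell2_coord (\<Sum>i\<in>I. x i) k = (\<Sum>i\<in>I. ell2_coord (x i) k)"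
  by (induction I rule: infinite_finite_induct) (simp_all add: coord_simps)

definition permute_coords :: "(nat \<Rightarrow> nat) \<Rightarrow> ell2 \<Rightarrow> ell2" where
  "permute_coords \<sigma> x = Abs_ell2 (\<lambda>k. ell2_coord x (\<sigma> k))"

context
  fixes \<sigma> :: "nat \<Rightarrow> nat"
  assumes \<sigma>: "\<And>k. \<sigma> (\<sigma> k) = k"
begin

lemma inj_involution: "inj \<sigma>" and range_involution: "range \<sigma> = UNIV"
  using \<sigma> by (metis injI) (metis \<sigma> surjI)

lemma coord_permute: "ell2_coord (permute_coords \<sigma> x) k = ell2_coord x (\<sigma> k)"
proof -
  have "summable (\<lambda>k. (ell2_coord x (\<sigma> k))\<^sup>2)"
    using summable_reindex[of "\<lambda>k. (ell2_coord x k)\<^sup>2" \<sigma>] ell2_coord[of x] inj_involution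
    by (simp add: o_def)
  then show ?thesis unfolding permute_coords_def by (subst Abs_ell2_inverse) auto
qed

lemma reflection_permute_coords: "reflection (permute_coords \<sigma>)"
  unfolding reflection_def
proof (intro conjI allI)
  show "linear (permute_coords \<sigma>)"
    by (rule linearI; rule ell2_eqI) (simp_all add: coord_permute coord_simps)
  show "permute_coords \<sigma> (permute_coords \<sigma> x) = x" for x
    by (rule ell2_eqI) (simp add: coord_permute \<sigma>)
  fix x
  have "(norm (permute_coords \<sigma> x))\<^sup>2 = suminf ((\<lambda>k. (ell2_coord x k)\<^sup>2) \<circ> \<sigma>)"
    by (simp add: norm_ell2_square coord_permute o_def)
  also have "\<dots> = (norm x)\<^sup>2"
    unfolding norm_ell2_square using ell2_coord[of x] inj_involution range_involution
    by (intro suminf_reindex) auto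
  finally show "norm (permute_coords \<sigma> x) = norm x" by simp
qed

lemma coord_split_permute:
  "ell2_coord (split_op a c (permute_coords \<sigma>) x) k =
     (a / 2) * (ell2_coord x k - ell2_coord x (\<sigma> k)) + (c / 2) * (ell2_coord x k + ell2_coord x (\<sigma> k))"
  by (simp add: split_op_def coord_simps coord_permute)

end

text \<open>The memories are tracked by the coordinates that can be nonzero.\<close>

definition supported_on :: "nat set \<Rightarrow> ell2 set" where
  "supported_on S = {x. \<forall>k. k \<notin> S \<longrightarrow> ell2_coord x k = 0}"

lemma subspace_supported_on: "Real_Vector_Spaces.subspace (supported_on S)"
  by (rule subspaceI) (auto simp: supported_on_def coord_simps)

lemma supported_on_mono: "S \<subseteq> T \<Longrightarrow> x \<in> supported_on S \<Longrightarrow> x \<in> supported_on T"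
  by (auto simp: supported_on_def)

lemma split_permute_supported_on:
  assumes "\<And>k. \<sigma> (\<sigma> k) = k" "x \<in> supported_on S" "S \<subseteq> T" "\<And>k. \<sigma> k \<in> S \<Longrightarrow> k \<in> T"
  shows "split_op a c (permute_coords \<sigma>) x \<in> supported_on T"
proof -
  have "ell2_coord x k = 0" "ell2_coord x (\<sigma> k) = 0" if "k \<notin> T" for k
    using that assms(2-4) unfolding supported_on_def by blast+
  then show ?thesis by (simp add: supported_on_def coord_split_permute assms(1))
qed


section \<open>Confinement of the memories\<close>

text \<open>
  A lower bound on the number of rounds of one type \<open>r\<close> is obtained from subspaces \<open>U c i\<close> and
  \<open>V c i\<close> that contain the local and the shared memory of node \<open>i\<close> as long as \<open>c\<close> rounds of type
  \<open>r\<close> have taken place. Rounds of the other types must therefore leave \<open>U c\<close> and \<open>V c\<close>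
  invariant, and a round of type \<open>r\<close> may increase the index by one.
\<close>

definition advance :: "round \<Rightarrow> round \<Rightarrow> nat \<Rightarrow> nat" where
  "advance r s c = (if s = r then Suc c else c)"

lemma memory_confined:
  fixes U :: "nat \<Rightarrow> nat \<Rightarrow> 'a::real_inner set" and V :: "nat \<Rightarrow> nat \<Rightarrow> 'b::real_inner set"
    and r :: round
  assumes U: "\<And>c i. Real_Vector_Spaces.subspace (U c i)" and V: "\<And>c i. Real_Vector_Spaces.subspace (V c i)"
    and gradU: "\<And>c i x. x \<in> U c i \<Longrightarrow> x \<in> U (advance r Gradient_Round c) i \<and>
          grad (f i) x \<in> U (advance r Gradient_Round c) i \<and>
          grad (fenchel_conjugate (f i)) x \<in> U (advance r Gradient_Round c) i"
    and gradV: "\<And>c i. V c i \<subseteq> V (advance r Gradient_Round c) i"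
    and multU: "\<And>c i y. y \<in> V c i \<Longrightarrow> adjoint (A i) y \<in> U (advance r Multiplication_Round c) i"
      "\<And>c i. adjoint (A i) (b i) \<in> U (advance r Multiplication_Round c) i"
    and multV: "\<And>c i x. x \<in> U c i \<Longrightarrow> A i x \<in> V (advance r Multiplication_Round c) i"
      "\<And>c i. b i \<in> V (advance r Multiplication_Round c) i"
    and commU: "\<And>c i. U c i \<subseteq> U (advance r Communication_Round c) i"
    and commV: "\<And>c i j. (i, j) \<in> E \<Longrightarrow> V c j \<subseteq> V (advance r Communication_Round c) i"
  shows "fst (memory_after f A b E rs) i \<subseteq> U (count_list rs r) i \<and>
         snd (memory_after f A b E rs) i \<subseteq> V (count_list rs r) i"
proof (induction rs arbitrary: i rule: rev_induct)
  case Nil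
  show ?case using subspace_0[OF U] subspace_0[OF V] by (simp add: memory_after_def)
next
  case (snoc s rs)
  obtain M H where MH: "memory_after f A b E rs = (M, H)" by fastforce
  define c where "c = count_list rs r"
  have M: "M i \<subseteq> U c i" and H: "H i \<subseteq> V c i" for i
    using snoc[of i] by (simp_all add: MH c_def)
  have step: "memory_after f A b E (rs @ [s]) = perform_round f A b E s (M, H)"
    using MH by (simp add: memory_after_def)
  have c': "count_list (rs @ [s]) r = advance r s c" by (simp add: advance_def c_def)
  show ?case unfolding step c'
  proof (cases s)
    case Gradient_Round
    have "span (\<Union>x\<in>M i. {x, grad (f i) x, grad (fenchel_conjugate (f i)) x})
            \<subseteq> U (advance r Gradient_Round c) i"
      by (rule span_minimal[OF _ U]) (use M gradU in blast)
    moreover have "H i \<subseteq> V (advance r Gradient_Round c) i" using H gradV by blast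
    ultimately show "fst (perform_round f A b E s (M, H)) i \<subseteq> U (advance r s c) i \<and>
      snd (perform_round f A b E s (M, H)) i \<subseteq> V (advance r s c) i"
      by (simp add: Gradient_Round)
  next
    case Multiplication_Round
    have "span ({adjoint (A i) (b i)} \<union> {adjoint (A i) y | y. y \<in> H i})
            \<subseteq> U (advance r Multiplication_Round c) i"
      by (rule span_minimal[OF _ U]) (use H multU in blast)
    moreover have "span ({b i} \<union> {A i x | x. x \<in> M i}) \<subseteq> V (advance r Multiplication_Round c) i"
      by (rule span_minimal[OF _ V]) (use M multV in blast)
    ultimately show "fst (perform_round f A b E s (M, H)) i \<subseteq> U (advance r s c) i \<and>
      snd (perform_round f A b E s (M, H)) i \<subseteq> V (advance r s c) i"
      by (simp add: Multiplication_Round)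
  next
    case Communication_Round
    have "span (\<Union>j\<in>{j. (i, j) \<in> E}. H j) \<subseteq> V (advance r Communication_Round c) i"
      by (rule span_minimal[OF _ V]) (use H commV in blast)
    moreover have "M i \<subseteq> U (advance r Communication_Round c) i" using M commU by blast
    ultimately show "fst (perform_round f A b E s (M, H)) i \<subseteq> U (advance r s c) i \<and>
      snd (perform_round f A b E s (M, H)) i \<subseteq> V (advance r s c) i"
      by (simp add: Communication_Round)
  qed
qed


section \<open>Gossip matrices with a prescribed condition number\<close>

lemma mult_mat_vec_sum:
  assumes "y \<in> carrier_vec n" "i < n"
  shows "vec_index (mat n n (\<lambda>(i, j). F i j) *\<^sub>v y) i = (\<Sum>j<n. F i j * vec_index y j)"
  using assms by (auto simp: scalar_prod_def lessThan_atLeast0 intro!: sum.cong)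

lemma spectrum_mat_iff:
  fixes F :: "nat \<Rightarrow> nat \<Rightarrow> real"
  shows "\<mu> \<in> spectrum (mat n n (\<lambda>(i, j). F i j)) \<longleftrightarrow>
    (\<exists>y. (\<exists>i<n. y i \<noteq> 0) \<and> (\<forall>i<n. (\<Sum>j<n. F i j * y j) = \<mu> * y i))" (is "?l \<longleftrightarrow> ?r")
proof
  assume ?l
  then obtain y where y: "y \<in> carrier_vec n" "y \<noteq> 0\<^sub>v n"
    "mat n n (\<lambda>(i, j). F i j) *\<^sub>v y = \<mu> \<cdot>\<^sub>v y"
    by (auto simp: spectrum_def eigenvalue_def eigenvector_def)
  have "(\<Sum>j<n. F i j * vec_index y j) = \<mu> * vec_index y i" if "i < n" for i
    using arg_cong[OF y(3), of "\<lambda>w. vec_index w i"] that y(1) mult_mat_vec_sum[OF y(1) that, of F]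
    by (simp del: index_mult_mat_vec)
  moreover have "\<exists>i<n. vec_index y i \<noteq> 0" using y(1,2) by (auto intro!: eq_vecI)
  ultimately show ?r by blast
next
  assume ?r
  then obtain y where y: "\<exists>i<n. y i \<noteq> 0" "\<forall>i<n. (\<Sum>j<n. F i j * y j) = \<mu> * y i" by blast
  have "mat n n (\<lambda>(i, j). F i j) *\<^sub>v vec n y = \<mu> \<cdot>\<^sub>v vec n y"
  proof (rule eq_vecI)
    fix i assume "i < dim_vec (\<mu> \<cdot>\<^sub>v vec n y)"
    then have "i < n" by simp
    then show "vec_index (mat n n (\<lambda>(i, j). F i j) *\<^sub>v vec n y) i = vec_index (\<mu> \<cdot>\<^sub>v vec n y) i"
      using y(2) by (subst mult_mat_vec_sum[of _ n]) auto
  qed simp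
  moreover have "vec n y \<noteq> 0\<^sub>v n" using y(1) by (metis index_vec index_zero_vec(1))
  ultimately show ?l
    by (auto simp: spectrum_def eigenvalue_def eigenvector_def intro!: exI[of _ "vec n y"])
qed

definition sparsity_pattern :: "nat \<Rightarrow> (nat \<Rightarrow> nat \<Rightarrow> real) \<Rightarrow> (nat \<times> nat) set" where
  "sparsity_pattern n F = {(i, j). i < n \<and> j < n \<and> i \<noteq> j \<and> F i j \<noteq> 0}"

lemma gossip_matrixI:
  fixes F :: "nat \<Rightarrow> nat \<Rightarrow> real"
  assumes sym: "\<And>i j. F i j = F j i" and diag: "\<And>i. i < n \<Longrightarrow> F i i \<noteq> 0"
    and psd: "\<And>y :: nat \<Rightarrow> real. 0 \<le> (\<Sum>i<n. y i * (\<Sum>j<n. F i j * y j))"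
    and kernel: "\<And>y :: nat \<Rightarrow> real.
      (\<forall>i<n. (\<Sum>j<n. F i j * y j) = 0) \<longleftrightarrow> (\<forall>i<n. \<forall>j<n. y i = y j)"
  shows "simple_graph n (sparsity_pattern n F)"
    and "gossip_matrix n (sparsity_pattern n F) (mat n n (\<lambda>(i, j). F i j))"
proof -
  show "simple_graph n (sparsity_pattern n F)"
    using sym by (auto simp: simple_graph_def sparsity_pattern_def sym_def irrefl_def)
  let ?W = "mat n n (\<lambda>(i, j). F i j)"
  have "transpose_mat ?W = ?W" by (rule eq_matI) (auto simp: sym)
  moreover have "0 \<le> scalar_prod y (?W *\<^sub>v y)" if y: "y \<in> carrier_vec n" for y
  proof -
    have "scalar_prod y (?W *\<^sub>v y) = (\<Sum>i<n. vec_index y i * (\<Sum>j<n. F i j * vec_index y j))"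
      unfolding scalar_prod_def
      using y by (auto simp: lessThan_atLeast0[symmetric] mult_mat_vec_sum[of _ n]
          simp del: index_mult_mat_vec intro!: sum.cong)
    then show ?thesis using psd by simp
  qed
  moreover have "?W *\<^sub>v y = 0\<^sub>v n \<longleftrightarrow> (\<forall>i<n. \<forall>j<n. vec_index y i = vec_index y j)"
    if y: "y \<in> carrier_vec n" for y
  proof -
    have "?W *\<^sub>v y = 0\<^sub>v n \<longleftrightarrow> (\<forall>i<n. vec_index (?W *\<^sub>v y) i = 0)"
      by (auto intro!: eq_vecI simp del: index_mult_mat_vec)
    also have "\<dots> \<longleftrightarrow> (\<forall>i<n. (\<Sum>j<n. F i j * vec_index y j) = 0)"
      by (simp add: mult_mat_vec_sum[OF y] del: index_mult_mat_vec)
    also have "\<dots> \<longleftrightarrow> (\<forall>i<n. \<forall>j<n. vec_index y i = vec_index y j)" by (rule kernel)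
    finally show ?thesis .
  qed
  ultimately show "gossip_matrix n (sparsity_pattern n F) ?W"
    using diag by (auto simp: gossip_matrix_def sparsity_pattern_def)
qed

lemma gossip_condition_numberI:
  fixes F :: "nat \<Rightarrow> nat \<Rightarrow> real"
  assumes "lo \<in> spectrum (mat n n (\<lambda>(i, j). F i j))" "hi \<in> spectrum (mat n n (\<lambda>(i, j). F i j))"
    and "0 < lo"
    and "\<And>\<mu>. \<mu> \<in> spectrum (mat n n (\<lambda>(i, j). F i j)) \<Longrightarrow> \<mu> = 0 \<or> lo \<le> \<mu> \<and> \<mu> \<le> hi"
  shows "gossip_condition_number (mat n n (\<lambda>(i, j). F i j)) = hi / lo"
proof -
  let ?S = "spectrum (mat n n (\<lambda>(i, j). F i j))"
  have fin: "finite ?S" using card_finite_spectrum(1)[of "mat n n (\<lambda>(i, j). F i j)" n] by simp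
  have hi: "0 \<le> hi" using assms(1,3,4) by fastforce
  have "Max ?S = hi" by (rule Max_eqI[OF fin]) (use assms hi in fastforce)+
  moreover have "Min (?S - {0}) = lo" by (rule Min_eqI) (use assms fin in fastforce)+
  ultimately show ?thesis by (simp add: gossip_condition_number_def)
qed


subsection \<open>Small condition numbers\<close>

text \<open>
  On three nodes the matrix \<open>u u\<^sup>T + (\<kappa> / 3) w w\<^sup>T\<close> with the orthogonal vectors \<open>u = (1, 0, -1)\<close>
  and \<open>w = (1, -2, 1)\<close> has the spectrum \<open>{0, 2, 2 \<kappa>}\<close>.
\<close>

definition three_node_gossip :: "real \<Rightarrow> nat \<Rightarrow> nat \<Rightarrow> real" where
  "three_node_gossip \<kappa> i j =
     (1 - real i) * (1 - real j) + \<kappa> / 3 * (if i = 1 then -2 else 1) * (if j = 1 then -2 else 1)"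

lemma three_node_gossip:
  assumes "1 \<le> \<kappa>"
  defines "F \<equiv> three_node_gossip \<kappa>"
  shows "simple_graph 3 (sparsity_pattern 3 F)"
    and "gossip_matrix 3 (sparsity_pattern 3 F) (mat 3 3 (\<lambda>(i, j). F i j))"
    and "gossip_condition_number (mat 3 3 (\<lambda>(i, j). F i j)) = \<kappa>"
proof -
  have all3: "(\<forall>i<3. P i) \<longleftrightarrow> P 0 \<and> P 1 \<and> P (2::nat)" for P
    by (auto simp: numeral_3_eq_3 numeral_2_eq_2 less_Suc_eq)
  have ex3: "(\<exists>i<3. P i) \<longleftrightarrow> P 0 \<or> P 1 \<or> P (2::nat)" for P
    using all3[of "\<lambda>i. \<not> P i"] by blast
  have sum3: "(\<Sum>j<3. h j) = h 0 + h 1 + h 2" for h :: "nat \<Rightarrow> real"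
    by (simp add: numeral_3_eq_3 numeral_2_eq_2)
  define u w where "u y = y 0 - y 2" and "w y = y 0 - 2 * y 1 + y 2" for y :: "nat \<Rightarrow> real"
  have Fy: "(\<Sum>j<3. F 0 j * y j) = u y + \<kappa> / 3 * w y"
    "(\<Sum>j<3. F 1 j * y j) = - 2 * (\<kappa> / 3) * w y"
    "(\<Sum>j<3. F 2 j * y j) = - u y + \<kappa> / 3 * w y" for y
    by (simp_all add: sum3 F_def three_node_gossip_def u_def w_def algebra_simps)
  have sym: "F i j = F j i" for i j by (simp add: F_def three_node_gossip_def)
  have diag: "F i i \<noteq> 0" for i
  proof -
    have "F i i = (1 - real i)\<^sup>2 + \<kappa> / 3 * (if i = 1 then -2 else 1)\<^sup>2"
      by (simp add: F_def three_node_gossip_def power2_eq_square)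
    moreover have "0 < \<kappa> / 3 * (if i = 1 then -2 else 1)\<^sup>2" using assms(1) by simp
    ultimately show ?thesis by (smt (verit) zero_le_power2)
  qed
  have form: "(\<Sum>i<3. y i * (\<Sum>j<3. F i j * y j)) = (u y)\<^sup>2 + \<kappa> / 3 * (w y)\<^sup>2" for y
    unfolding sum3[of "\<lambda>i. y i * (\<Sum>j<3. F i j * y j)"] Fy
    by (simp add: u_def w_def power2_eq_square algebra_simps)
  have psd: "0 \<le> (\<Sum>i<3. y i * (\<Sum>j<3. F i j * y j))" for y
    unfolding form using assms(1) by simp
  have kernel: "(\<forall>i<3. (\<Sum>j<3. F i j * y j) = 0) \<longleftrightarrow> (\<forall>i<3. \<forall>j<3. y i = y j)" for y
  proof -
    have "(\<forall>i<3. (\<Sum>j<3. F i j * y j) = 0) \<longleftrightarrow> u y = 0 \<and> w y = 0"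
      unfolding all3 Fy using assms(1) by auto
    also have "\<dots> \<longleftrightarrow> y 0 = y 1 \<and> y 1 = y 2" by (auto simp: u_def w_def)
    also have "\<dots> \<longleftrightarrow> (\<forall>i<3. \<forall>j<3. y i = y j)" unfolding all3 by auto
    finally show ?thesis .
  qed
  show "simple_graph 3 (sparsity_pattern 3 F)"
    "gossip_matrix 3 (sparsity_pattern 3 F) (mat 3 3 (\<lambda>(i, j). F i j))"
    by (rule gossip_matrixI[OF sym diag psd kernel])+
  have "gossip_condition_number (mat 3 3 (\<lambda>(i, j). F i j)) = (2 * \<kappa>) / 2"
  proof (rule gossip_condition_numberI)
    show "2 \<in> spectrum (mat 3 3 (\<lambda>(i, j). F i j))"
      unfolding spectrum_mat_iff all3 ex3 Fy
      by (rule exI[of _ "\<lambda>i. 1 - real i"]) (simp add: u_def w_def)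
    show "2 * \<kappa> \<in> spectrum (mat 3 3 (\<lambda>(i, j). F i j))"
      unfolding spectrum_mat_iff all3 ex3 Fy
      by (rule exI[of _ "\<lambda>i. if i = 1 then -2 else 1"]) (simp add: u_def w_def)
    fix \<mu> assume "\<mu> \<in> spectrum (mat 3 3 (\<lambda>(i, j). F i j))"
    then obtain y where y: "y 0 \<noteq> 0 \<or> y 1 \<noteq> 0 \<or> y 2 \<noteq> 0"
      and e: "u y + \<kappa> / 3 * w y = \<mu> * y 0" "- 2 * (\<kappa> / 3) * w y = \<mu> * y 1"
        "- u y + \<kappa> / 3 * w y = \<mu> * y 2"
      unfolding spectrum_mat_iff all3 ex3 Fy by blast
    have "\<mu> * u y = \<mu> * y 0 - \<mu> * y 2" "\<mu> * w y = \<mu> * y 0 - 2 * (\<mu> * y 1) + \<mu> * y 2"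
      "\<mu> * (y 0 + y 1 + y 2) = \<mu> * y 0 + \<mu> * y 1 + \<mu> * y 2"
      by (simp_all add: u_def w_def algebra_simps)
    then have "2 * u y = \<mu> * u y" "2 * \<kappa> * w y = \<mu> * w y" "\<mu> * (y 0 + y 1 + y 2) = 0"
      unfolding e[symmetric] by linarith+
    then have "\<mu> = 2 \<or> \<mu> = 2 * \<kappa> \<or> (u y = 0 \<and> w y = 0 \<and> \<mu> * (y 0 + y 1 + y 2) = 0)"
      by (metis mult_right_cancel)
    moreover have "\<mu> = 0" if "u y = 0" "w y = 0" "\<mu> * (y 0 + y 1 + y 2) = 0"
      using that y by (auto simp: u_def w_def)
    ultimately show "\<mu> = 0 \<or> 2 \<le> \<mu> \<and> \<mu> \<le> 2 * \<kappa>" using assms(1) by auto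
  qed simp
  then show "gossip_condition_number (mat 3 3 (\<lambda>(i, j). F i j)) = \<kappa>" by simp
qed


subsection \<open>Large condition numbers\<close>

text \<open>
  The Laplacian of the path on \<open>n\<close> nodes whose edge between \<open>j - 1\<close> and \<open>j\<close> has the weight
  \<open>j (n - j)\<close>. These weights vanish at both ends of the path, so that no boundary terms occur, and they
  have a constant second difference, so that polynomials of degree at most \<open>d\<close> are mapped to
  such polynomials and the first eigenvectors are explicit.
\<close>

definition path_weight :: "nat \<Rightarrow> nat \<Rightarrow> real" where
  "path_weight n j = real j * (real n - real j)"

definition path_laplacian :: "nat \<Rightarrow> (nat \<Rightarrow> real) \<Rightarrow> nat \<Rightarrow> real" where
  "path_laplacian n y i =
     path_weight n i * (y i - y (i - 1)) - path_weight n (Suc i) * (y (Suc i) - y i)"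

definition path_matrix :: "nat \<Rightarrow> nat \<Rightarrow> nat \<Rightarrow> real" where
  "path_matrix n i j =
     (if j = i then path_weight n i + path_weight n (Suc i) else 0) -
     (if j = Suc i then path_weight n (Suc i) else 0) - (if i = Suc j then path_weight n i else 0)"

lemma path_weight_simps [simp]: "path_weight n 0 = 0" "path_weight n n = 0"
  by (simp_all add: path_weight_def)

lemma path_weight_pos: "0 < j \<Longrightarrow> j < n \<Longrightarrow> 0 < path_weight n j"
  by (simp add: path_weight_def)

lemma path_weight_nonneg: "j \<le> n \<Longrightarrow> 0 \<le> path_weight n j"
  by (simp add: path_weight_def)

lemma path_weight_le: "path_weight n j \<le> (real n)\<^sup>2 / 4"
proof -
  have "0 \<le> (real n / 2 - real j)\<^sup>2" by simp
  then show ?thesis by (simp add: path_weight_def power2_eq_square algebra_simps)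
qed

lemma path_matrix_sym: "path_matrix n i j = path_matrix n j i"
  by (auto simp: path_matrix_def)

lemma path_matrix_sum:
  assumes "i < n"
  shows "(\<Sum>j<n. path_matrix n i j * y j) = path_laplacian n y i"
proof -
  have "(\<Sum>j<n. path_matrix n i j * y j) =
      (\<Sum>j<n. if j = i then (path_weight n i + path_weight n (Suc i)) * y j else 0) -
      (\<Sum>j<n. if j = Suc i then path_weight n (Suc i) * y j else 0) -
      (\<Sum>j<n. if j = i - 1 then path_weight n i * y j else 0)"
    unfolding sum_subtractf[symmetric]
    by (intro sum.cong) (auto simp: path_matrix_def algebra_simps split: nat_diff_split)
  also have "\<dots> = (path_weight n i + path_weight n (Suc i)) * y i -
      (if Suc i < n then path_weight n (Suc i) * y (Suc i) else 0) - path_weight n i * y (i - 1)"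
    using assms by (auto simp: sum.delta)
  also have "\<dots> = path_laplacian n y i"
  proof (cases "Suc i < n")
    case False
    then have "n = Suc i" using assms by simp
    then show ?thesis by (simp add: path_laplacian_def algebra_simps)
  qed (simp add: path_laplacian_def algebra_simps)
  finally show ?thesis .
qed

lemma path_laplacian_cong:
  assumes "\<And>i. i < n \<Longrightarrow> y i = z i" "i < n"
  shows "path_laplacian n y i = path_laplacian n z i"
  using assms by (simp flip: path_matrix_sum)

lemma path_laplacian_linear:
  "path_laplacian n (\<lambda>i. a * y i + c * z i) i = a * path_laplacian n y i + c * path_laplacian n z i"
  by (simp add: path_laplacian_def algebra_simps)

lemma summation_by_parts:
  fixes y g :: "nat \<Rightarrow> real"
  shows "(\<Sum>i<Suc M. y i * (g i - g (Suc i))) =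
    y 0 * g 0 - y M * g (Suc M) + (\<Sum>i<M. g (Suc i) * (y (Suc i) - y i))"
  by (induction M) (simp_all add: algebra_simps)

lemma path_laplacian_form:
  "(\<Sum>i<Suc M. y i * path_laplacian (Suc M) z i) =
     (\<Sum>i<M. path_weight (Suc M) (Suc i) * (z (Suc i) - z i) * (y (Suc i) - y i))"
  using summation_by_parts[of y "\<lambda>i. path_weight (Suc M) i * (z i - z (i - 1))" M]
  by (simp add: path_laplacian_def)

lemma path_laplacian_selfadjoint:
  "0 < n \<Longrightarrow> (\<Sum>i<n. y i * path_laplacian n z i) = (\<Sum>i<n. z i * path_laplacian n y i)"
  by (cases n) (simp_all only: path_laplacian_form less_irrefl mult.assoc mult.commute[of "y _ - y _"])

lemma path_laplacian_nonneg: "0 < n \<Longrightarrow> 0 \<le> (\<Sum>i<n. y i * path_laplacian n y i)"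
proof (cases n)
  case (Suc M)
  show ?thesis
    unfolding Suc path_laplacian_form mult.assoc
    by (intro sum_nonneg mult_nonneg_nonneg[OF path_weight_nonneg zero_le_square]) auto
qed simp

text \<open>
  This is the spectral gap: no eigenvalue lies strictly between \<open>0\<close> and \<open>2\<close>. With
  \<open>d\<^sub>i = y\<^sub>i - y\<^sub>i\<^sub>-\<^sub>1\<close> and the weights \<open>v\<^sub>i\<close>, the weight itself is the ground state of the dual problem
  for the fluxes \<open>v\<^sub>i d\<^sub>i\<close>, and the difference of the two sides is
  \<open>\<Sum> v\<^sub>i v\<^sub>i\<^sub>+\<^sub>1 (d\<^sub>i - d\<^sub>i\<^sub>+\<^sub>1)\<^sup>2\<close>. The factor \<open>2\<close> is the negative second difference of \<open>v\<close>.
\<close>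

lemma path_laplacian_gap:
  assumes "0 < n"
  shows "2 * (\<Sum>i<n. y i * path_laplacian n y i) \<le> (\<Sum>i<n. (path_laplacian n y i)\<^sup>2)"
proof -
  obtain M where n: "n = Suc M" using assms by (cases n) auto
  define v where "v = path_weight n"
  define d where "d i = y i - y (i - 1)" for i
  have lap: "path_laplacian n y i = v i * d i - v (Suc i) * d (Suc i)" for i
    by (simp add: path_laplacian_def v_def d_def)
  have "2 * (\<Sum>i<n. y i * path_laplacian n y i) = (\<Sum>i<M. v (Suc i) * (d (Suc i))\<^sup>2 * 2)"
    unfolding n path_laplacian_form
    by (simp add: sum_distrib_left v_def d_def n power2_eq_square ac_simps)
  also have "\<dots> = (\<Sum>i<M. v (Suc i) * (d (Suc i))\<^sup>2 * ((v (Suc i) - v (Suc (Suc i))) - (v i - v (Suc i))))"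
    by (intro sum.cong) (simp_all add: v_def path_weight_def algebra_simps)
  also have "\<dots> = (\<Sum>i<n. (v i - v (Suc i)) * (v i * (d i)\<^sup>2 - v (Suc i) * (d (Suc i))\<^sup>2))"
    using summation_by_parts[of "\<lambda>i. v i - v (Suc i)" "\<lambda>i. v i * (d i)\<^sup>2" M]
    by (simp add: n v_def)
  also have "\<dots> \<le> (\<Sum>i<n. (path_laplacian n y i)\<^sup>2)"
  proof (intro sum_mono)
    fix i assume "i \<in> {..<n}"
    then have "0 \<le> v i * v (Suc i)" unfolding v_def by (simp add: path_weight_nonneg)
    then have "0 \<le> v i * v (Suc i) * (d i - d (Suc i))\<^sup>2" by simp
    also have "\<dots> = (path_laplacian n y i)\<^sup>2 -
        (v i - v (Suc i)) * (v i * (d i)\<^sup>2 - v (Suc i) * (d (Suc i))\<^sup>2)"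
      unfolding lap by (simp add: power2_eq_square algebra_simps)
    finally show "(v i - v (Suc i)) * (v i * (d i)\<^sup>2 - v (Suc i) * (d (Suc i))\<^sup>2)
        \<le> (path_laplacian n y i)\<^sup>2" by simp
  qed
  finally show ?thesis .
qed

lemma path_laplacian_form_le:
  assumes "0 < n"
  shows "(\<Sum>i<n. y i * path_laplacian n y i) \<le> (real n)\<^sup>2 * (\<Sum>i<n. (y i)\<^sup>2)"
proof -
  obtain M where n: "n = Suc M" using assms by (cases n) auto
  have "(\<Sum>i<n. y i * path_laplacian n y i) \<le> (\<Sum>i<M. (real n)\<^sup>2 / 2 * (y (Suc i))\<^sup>2 + (real n)\<^sup>2 / 2 * (y i)\<^sup>2)"
    unfolding n path_laplacian_form
  proof (intro sum_mono)
    fix i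
    have "(y (Suc i) - y i)\<^sup>2 \<le> 2 * ((y (Suc i))\<^sup>2 + (y i)\<^sup>2)"
      using zero_le_power2[of "y (Suc i) + y i"] by (simp add: power2_eq_square algebra_simps)
    then have "path_weight n (Suc i) * (y (Suc i) - y i)\<^sup>2 \<le> (real n)\<^sup>2 / 4 * (2 * ((y (Suc i))\<^sup>2 + (y i)\<^sup>2))"
      by (intro mult_mono path_weight_le) auto
    then show "path_weight (Suc M) (Suc i) * (y (Suc i) - y i) * (y (Suc i) - y i)
        \<le> (real (Suc M))\<^sup>2 / 2 * (y (Suc i))\<^sup>2 + (real (Suc M))\<^sup>2 / 2 * (y i)\<^sup>2"
      unfolding n by (simp add: power2_eq_square[of "y (Suc i) - y i"] algebra_simps)
  qed
  also have "\<dots> = (real n)\<^sup>2 / 2 * (\<Sum>i<M. (y (Suc i))\<^sup>2) + (real n)\<^sup>2 / 2 * (\<Sum>i<M. (y i)\<^sup>2)"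
    by (simp add: sum.distrib sum_distrib_left)
  also have "\<dots> \<le> (real n)\<^sup>2 / 2 * (\<Sum>i<n. (y i)\<^sup>2) + (real n)\<^sup>2 / 2 * (\<Sum>i<n. (y i)\<^sup>2)"
  proof (intro add_mono mult_left_mono)
    show "(\<Sum>i<M. (y (Suc i))\<^sup>2) \<le> (\<Sum>i<n. (y i)\<^sup>2)"
      unfolding n sum.lessThan_Suc_shift by simp
  qed (simp_all add: n)
  finally show ?thesis by simp
qed

lemma path_spectrum_bounds:
  assumes y: "\<exists>i<n. y i \<noteq> 0" "\<forall>i<n. path_laplacian n y i = \<mu> * y i" and "0 < n"
  shows "\<mu> = 0 \<or> 2 \<le> \<mu>" "\<mu> \<le> (real n)\<^sup>2"
proof -
  define S where "S = (\<Sum>i<n. (y i)\<^sup>2)"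
  obtain i0 where "i0 < n" "y i0 \<noteq> 0" using y(1) by blast
  then have S: "0 < S" unfolding S_def by (intro sum_pos2[of _ i0]) auto
  have form: "(\<Sum>i<n. y i * path_laplacian n y i) = \<mu> * S"
    unfolding S_def sum_distrib_left using y(2) by (intro sum.cong) (auto simp: power2_eq_square)
  have sq: "(\<Sum>i<n. (path_laplacian n y i)\<^sup>2) = \<mu>\<^sup>2 * S"
    unfolding S_def sum_distrib_left using y(2) by (intro sum.cong) (auto simp: power_mult_distrib)
  have "0 \<le> \<mu> * S" using path_laplacian_nonneg[OF assms(3), of y] form by simp
  then have "0 \<le> \<mu>" using S by (simp add: zero_le_mult_iff)
  moreover have "(2 * \<mu>) * S \<le> (\<mu> * \<mu>) * S"
    using path_laplacian_gap[OF assms(3), of y] form sq by (simp add: power2_eq_square)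
  then have "2 * \<mu> \<le> \<mu> * \<mu>" using S by (simp only: mult_le_cancel_right_pos)
  ultimately show "\<mu> = 0 \<or> 2 \<le> \<mu>" by (cases "\<mu> = 0") auto
  show "\<mu> \<le> (real n)\<^sup>2"
    using path_laplacian_form_le[OF assms(3), of y] form S by (simp add: S_def[symmetric])
qed


text \<open>
  The Laplacian \<open>L\<close> itself has a condition number of order \<open>n\<^sup>2\<close> that cannot be chosen freely. The
  polynomial \<open>p(\<nu>) = \<nu> (1 + t (\<nu> - 2))\<close> fixes the eigenvalues \<open>0\<close> and \<open>2\<close> and stretches the others, so
  the condition number of \<open>p(L)\<close> grows continuously with \<open>t \<ge> 0\<close>; and \<open>p(L)\<close> only links nodes at
  distance at most two.
\<close>

definition stretched_path_matrix :: "nat \<Rightarrow> real \<Rightarrow> nat \<Rightarrow> nat \<Rightarrow> real" where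
  "stretched_path_matrix n t i j =
     (1 - 2 * t) * path_matrix n i j + t * (\<Sum>k<n. path_matrix n i k * path_matrix n k j)"

lemma stretched_path_matrix_sym: "stretched_path_matrix n t i j = stretched_path_matrix n t j i"
  unfolding stretched_path_matrix_def
  by (simp add: path_matrix_sym[of n i] path_matrix_sym[of n _ j] mult.commute)

lemma stretched_path_matrix_sum:
  assumes "i < n"
  shows "(\<Sum>j<n. stretched_path_matrix n t i j * y j) =
    (1 - 2 * t) * path_laplacian n y i + t * path_laplacian n (path_laplacian n y) i"
proof -
  have "(\<Sum>j<n. (\<Sum>k<n. path_matrix n i k * path_matrix n k j) * y j) =
      (\<Sum>k<n. path_matrix n i k * (\<Sum>j<n. path_matrix n k j * y j))"
    unfolding sum_distrib_left sum_distrib_right mult.assoc by (rule sum.swap)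
  also have "\<dots> = (\<Sum>k<n. path_matrix n i k * path_laplacian n y k)"
    by (intro sum.cong) (auto simp: path_matrix_sum)
  also have "\<dots> = path_laplacian n (path_laplacian n y) i" using assms by (rule path_matrix_sum)
  finally show ?thesis
    by (simp add: stretched_path_matrix_def distrib_right sum.distrib mult.assoc
        sum_distrib_left[symmetric] path_matrix_sum[OF assms])
qed

lemma stretched_path_matrix_far: "2 < i - j \<or> 2 < j - i \<Longrightarrow> stretched_path_matrix n t i j = 0"
  by (auto simp: stretched_path_matrix_def path_matrix_def intro!: sum.neutral)

lemma stretched_path_matrix_diag_pos:
  assumes "3 \<le> n" "i < n" "0 \<le> t"
  shows "0 < stretched_path_matrix n t i i"
proof -
  define v where "v = path_weight n"
  define D where "D = v i + v (Suc i)"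
  have D: "2 \<le> D"
  proof -
    have "D = real i * (2 * (real n - 1 - real i)) + (real n - 1)"
      by (simp add: D_def v_def path_weight_def algebra_simps)
    moreover have "0 \<le> real i * (2 * (real n - 1 - real i))" using assms(2) by simp
    ultimately show ?thesis using assms(1) by simp
  qed
  have pm: "path_matrix n i i = D" by (simp add: path_matrix_def D_def v_def)
  have "D * D \<le> (\<Sum>k<n. path_matrix n i k * path_matrix n k i)"
  proof -
    have "0 \<le> path_matrix n i k * path_matrix n k i" for k
      by (metis path_matrix_sym zero_le_square)
    then show ?thesis
      using member_le_sum[of i "{..<n}" "\<lambda>k. path_matrix n i k * path_matrix n k i"] assms(2)
      by (simp add: pm)
  qed
  then have "t * (D * D) \<le> t * (\<Sum>k<n. path_matrix n i k * path_matrix n k i)"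
    using assms(3) by (rule mult_left_mono)
  then have "(1 - 2 * t) * D + t * (D * D) \<le> stretched_path_matrix n t i i"
    by (simp add: stretched_path_matrix_def pm)
  moreover have "(1 - 2 * t) * D + t * (D * D) = D + t * (D * (D - 2))" by (simp add: algebra_simps)
  moreover have "0 \<le> t * (D * (D - 2))" using D assms(3) by simp
  ultimately show ?thesis using D by linarith
qed

lemma stretched_path_form:
  assumes "0 < n" "0 \<le> t"
  shows "(\<Sum>i<n. y i * path_laplacian n y i) \<le> (\<Sum>i<n. y i * (\<Sum>j<n. stretched_path_matrix n t i j * y j))"
proof -
  have "(\<Sum>i<n. y i * (\<Sum>j<n. stretched_path_matrix n t i j * y j)) =
      (\<Sum>i<n. (1 - 2 * t) * (y i * path_laplacian n y i) + t * (y i * path_laplacian n (path_laplacian n y) i))"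
    by (intro sum.cong refl, subst stretched_path_matrix_sum) (auto simp: algebra_simps)
  also have "\<dots> = (1 - 2 * t) * (\<Sum>i<n. y i * path_laplacian n y i) +
      t * (\<Sum>i<n. y i * path_laplacian n (path_laplacian n y) i)"
    by (simp add: sum.distrib sum_distrib_left)
  also have "(\<Sum>i<n. y i * path_laplacian n (path_laplacian n y) i) = (\<Sum>i<n. (path_laplacian n y i)\<^sup>2)"
    using path_laplacian_selfadjoint[OF assms(1)] by (simp add: power2_eq_square)
  finally have "(\<Sum>i<n. y i * (\<Sum>j<n. stretched_path_matrix n t i j * y j)) =
      (\<Sum>i<n. y i * path_laplacian n y i) +
      t * ((\<Sum>i<n. (path_laplacian n y i)\<^sup>2) - 2 * (\<Sum>i<n. y i * path_laplacian n y i))"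
    by (simp add: algebra_simps)
  moreover have "0 \<le> t * ((\<Sum>i<n. (path_laplacian n y i)\<^sup>2) - 2 * (\<Sum>i<n. y i * path_laplacian n y i))"
    using path_laplacian_gap[OF assms(1), of y] assms(2) by simp
  ultimately show ?thesis by simp
qed

lemma path_laplacian_kernel:
  assumes "(\<Sum>i<n. y i * path_laplacian n y i) \<le> 0" "i < n"
  shows "y i = y 0"
  using assms(2)
proof (induction i)
  case (Suc i)
  obtain M where n: "n = Suc M" using Suc.prems by (cases n) auto
  have "(\<Sum>i<M. path_weight n (Suc i) * (y (Suc i) - y i)\<^sup>2) \<le> 0"
    using assms(1) unfolding n path_laplacian_form by (simp add: power2_eq_square mult.assoc)
  moreover have nn: "0 \<le> path_weight n (Suc i) * (y (Suc i) - y i)\<^sup>2" if "i < M" for i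
    using that by (simp add: path_weight_nonneg n)
  ultimately have "(\<Sum>i<M. path_weight n (Suc i) * (y (Suc i) - y i)\<^sup>2) = 0"
    by (intro antisym sum_nonneg) auto
  then have "path_weight n (Suc i) * (y (Suc i) - y i)\<^sup>2 = 0"
    using nn Suc.prems n by (subst (asm) sum_nonneg_eq_0_iff) auto
  then show ?case using path_weight_pos[of "Suc i" n] Suc by simp
qed simp

lemma linear_path_eigenvector:
  "path_laplacian n (\<lambda>i. 2 * real i - (real n - 1)) i = 2 * (2 * real i - (real n - 1))"
  by (cases i) (simp_all add: path_laplacian_def path_weight_def algebra_simps)

lemma quadratic_path_eigenvector:
  "path_laplacian n (\<lambda>i. 6 * (real i)\<^sup>2 - 6 * (real n - 1) * real i + (real n - 1) * (real n - 2)) i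
     = 6 * (6 * (real i)\<^sup>2 - 6 * (real n - 1) * real i + (real n - 1) * (real n - 2))"
  by (cases i) (simp_all add: path_laplacian_def path_weight_def power2_eq_square algebra_simps)

text \<open>
  The spectral mapping theorem for \<open>p\<close>: if \<open>a\<close> and \<open>c\<close> are the roots of \<open>p(\<nu>) = \<mu>\<close>, then
  \<open>p(L) - \<mu> = t (L - a) (L - c)\<close>, so a kernel vector \<open>y\<close> of the left-hand side is an eigenvector of
  \<open>L\<close> for \<open>c\<close>, or else \<open>(L - c) y\<close> is one for \<open>a\<close>.
\<close>

lemma stretched_path_eigenvalue:
  assumes y: "\<exists>i<n. y i \<noteq> 0" and t: "0 \<le> t" and \<mu>: "0 \<le> \<mu>"
    and eig: "\<forall>i<n. (1 - 2 * t) * path_laplacian n y i + t * path_laplacian n (path_laplacian n y) i = \<mu> * y i"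
  shows "\<exists>\<nu> z. (\<exists>i<n. z i \<noteq> 0) \<and> (\<forall>i<n. path_laplacian n z i = \<nu> * z i) \<and> \<mu> = \<nu> * (1 + t * (\<nu> - 2))"
proof (cases "t = 0")
  case True
  then show ?thesis using y eig by (intro exI[of _ \<mu>] exI[of _ y]) simp
next
  case False
  define s where "s = sqrt ((1 - 2 * t)\<^sup>2 + 4 * t * \<mu>)"
  have s2: "s\<^sup>2 = (1 - 2 * t)\<^sup>2 + 4 * t * \<mu>" unfolding s_def using t \<mu> by simp
  define a c where "a = (2 * t - 1 + s) / (2 * t)" and "c = (2 * t - 1 - s) / (2 * t)"
  have ta: "2 * t * a = 2 * t - 1 + s" and tc: "2 * t * c = 2 * t - 1 - s"
    using False by (simp_all add: a_def c_def)
  have sum: "t * (a + c) = 2 * t - 1" using ta tc by (simp add: algebra_simps)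
  have "4 * t * (t * (a * c)) = (2 * t * a) * (2 * t * c)" by simp
  also have "\<dots> = (1 - 2 * t)\<^sup>2 - s\<^sup>2" unfolding ta tc by (simp add: power2_eq_square algebra_simps)
  also have "\<dots> = 4 * t * (- \<mu>)" unfolding s2 by simp
  finally have prod: "t * (a * c) = - \<mu>" using False by (metis mult_left_cancel mult_eq_0_iff zero_neq_numeral)
  have root: "\<mu> = \<nu> * (1 + t * (\<nu> - 2))" if "\<nu> = a \<or> \<nu> = c" for \<nu>
  proof -
    have "\<nu> * (1 + t * (\<nu> - 2)) = t * \<nu>\<^sup>2 - \<nu> * (2 * t - 1)" by (simp add: power2_eq_square algebra_simps)
    also have "\<dots> = t * (\<nu>\<^sup>2 - \<nu> * (a + c))" unfolding sum[symmetric] by (simp add: algebra_simps)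
    also have "\<dots> = - (t * (a * c))" using that by (auto simp: power2_eq_square algebra_simps)
    finally show ?thesis using prod by simp
  qed
  define z where "z i = path_laplacian n y i - c * y i" for i
  show ?thesis
  proof (cases "\<exists>i<n. z i \<noteq> 0")
    case True
    have "path_laplacian n z i = a * z i" if "i < n" for i
    proof -
      have eqz: "path_laplacian n z i = path_laplacian n (path_laplacian n y) i - c * path_laplacian n y i"
        using path_laplacian_linear[of n 1 "path_laplacian n y" "- c" y i] by (simp add: z_def[abs_def])
      have "t * (path_laplacian n z i - a * z i) =
          t * path_laplacian n (path_laplacian n y) i - (t * (a + c)) * path_laplacian n y i + (t * (a * c)) * y i"
        unfolding eqz by (simp add: z_def algebra_simps)
      also have "\<dots> = 0"
        unfolding sum prod using eig that by (auto simp: algebra_simps)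
      finally show ?thesis using False by simp
    qed
    then show ?thesis using True root by blast
  next
    case False
    then have "\<forall>i<n. path_laplacian n y i = c * y i" by (auto simp: z_def)
    then show ?thesis using y root by blast
  qed
qed

lemma stretched_path_gossip:
  assumes n: "3 \<le> n" and \<kappa>: "(real n)\<^sup>2 \<le> \<kappa>"
  shows "\<exists>t. simple_graph n (sparsity_pattern n (stretched_path_matrix n t)) \<and>
    gossip_matrix n (sparsity_pattern n (stretched_path_matrix n t))
      (mat n n (\<lambda>(i, j). stretched_path_matrix n t i j)) \<and>
    gossip_condition_number (mat n n (\<lambda>(i, j). stretched_path_matrix n t i j)) = \<kappa>"
proof -
  have n0: "0 < n" using n by simp
  let ?L = "mat n n (\<lambda>(i, j). path_matrix n i j)"
  have specL: "\<nu> \<in> spectrum ?L \<longleftrightarrow> (\<exists>y. (\<exists>i<n. y i \<noteq> 0) \<and> (\<forall>i<n. path_laplacian n y i = \<nu> * y i))" for \<nu>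
    unfolding spectrum_mat_iff by (simp add: path_matrix_sum)
  define \<Lambda> where "\<Lambda> = Max (spectrum ?L)"
  have fin: "finite (spectrum ?L)" using card_finite_spectrum(1)[of ?L n] by simp
  have six: "6 \<in> spectrum ?L"
    unfolding specL
    using n quadratic_path_eigenvector[of n]
    by (intro exI[of _ "\<lambda>i. 6 * (real i)\<^sup>2 - 6 * (real n - 1) * real i + (real n - 1) * (real n - 2)"])
       (auto intro!: exI[of _ 0])
  have \<Lambda>: "\<Lambda> \<in> spectrum ?L" and \<Lambda>max: "\<nu> \<le> \<Lambda>" if "\<nu> \<in> spectrum ?L" for \<nu>
    using fin six that unfolding \<Lambda>_def by (auto intro: Max_in Max_ge)
  have \<Lambda>6: "6 \<le> \<Lambda>" using \<Lambda>max[OF six] .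
  have bounds: "\<nu> = 0 \<or> 2 \<le> \<nu>" "\<nu> \<le> (real n)\<^sup>2" if "\<nu> \<in> spectrum ?L" for \<nu>
    using that path_spectrum_bounds[OF _ _ n0] unfolding specL by blast+
  \<comment> \<open>the parameter for which \<open>p(\<Lambda>) = 2 \<kappa>\<close>\<close>
  define t where "t = (2 * \<kappa> / \<Lambda> - 1) / (\<Lambda> - 2)"
  have "\<Lambda> \<le> 2 * \<kappa>" using bounds(2)[OF \<Lambda>[OF six]] \<kappa> zero_le_power2[of "real n"] by linarith
  then have t: "0 \<le> t" unfolding t_def using \<Lambda>6 by (auto simp: field_simps)
  have p\<Lambda>: "\<Lambda> * (1 + t * (\<Lambda> - 2)) = 2 * \<kappa>" unfolding t_def using \<Lambda>6 by (simp add: field_simps)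
  let ?F = "stretched_path_matrix n t"
  have spec: "\<mu> \<in> spectrum (mat n n (\<lambda>(i, j). ?F i j)) \<longleftrightarrow> (\<exists>y. (\<exists>i<n. y i \<noteq> 0) \<and>
      (\<forall>i<n. (1 - 2 * t) * path_laplacian n y i + t * path_laplacian n (path_laplacian n y) i = \<mu> * y i))" for \<mu>
    unfolding spectrum_mat_iff by (simp add: stretched_path_matrix_sum)
  have mapped: "\<nu> * (1 + t * (\<nu> - 2)) \<in> spectrum (mat n n (\<lambda>(i, j). ?F i j))" if l: "\<nu> \<in> spectrum ?L" for \<nu>
  proof -
    obtain y where y: "\<exists>i<n. y i \<noteq> 0" "\<forall>i<n. path_laplacian n y i = \<nu> * y i"
      using iffD1[OF specL l] by blast
    have "path_laplacian n (path_laplacian n y) i = \<nu> * (\<nu> * y i)" if "i < n" for i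
    proof -
      have "path_laplacian n (path_laplacian n y) i = path_laplacian n (\<lambda>i. \<nu> * y i + 0 * y i) i"
        by (rule path_laplacian_cong) (use y(2) that in auto)
      also have "\<dots> = \<nu> * (\<nu> * y i)" unfolding path_laplacian_linear using y(2) that by simp
      finally show ?thesis .
    qed
    then have "\<forall>i<n. (1 - 2 * t) * path_laplacian n y i + t * path_laplacian n (path_laplacian n y) i =
        (\<nu> * (1 + t * (\<nu> - 2))) * y i" using y(2) by (simp add: algebra_simps)
    then show ?thesis unfolding spec using y(1) by blast
  qed
  have psd: "0 \<le> (\<Sum>i<n. y i * (\<Sum>j<n. ?F i j * y j))" for y
    using stretched_path_form[OF n0 t, of y] path_laplacian_nonneg[OF n0, of y] by linarith
  have const: "path_laplacian n y i = 0" if "\<forall>i<n. \<forall>j<n. y i = y j" "i < n" for y i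
  proof -
    have "path_laplacian n y i = path_laplacian n (\<lambda>_. y 0) i"
      by (rule path_laplacian_cong[OF _ that(2)]) (use that(1) n0 in blast)
    then show ?thesis by (simp add: path_laplacian_def)
  qed
  have kernel: "(\<forall>i<n. (\<Sum>j<n. ?F i j * y j) = 0) \<longleftrightarrow> (\<forall>i<n. \<forall>j<n. y i = y j)" for y
  proof
    assume "\<forall>i<n. (\<Sum>j<n. ?F i j * y j) = 0"
    then have "(\<Sum>i<n. y i * path_laplacian n y i) \<le> 0" using stretched_path_form[OF n0 t, of y] by simp
    from path_laplacian_kernel[OF this] show "\<forall>i<n. \<forall>j<n. y i = y j" by metis
  next
    assume c: "\<forall>i<n. \<forall>j<n. y i = y j"
    then have "\<forall>i<n. path_laplacian n y i = 0" using const by blast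
    moreover from this have "\<forall>i<n. path_laplacian n (path_laplacian n y) i = 0" using const by simp
    ultimately show "\<forall>i<n. (\<Sum>j<n. ?F i j * y j) = 0" by (simp add: stretched_path_matrix_sum)
  qed
  have diag: "?F i i \<noteq> 0" if "i < n" for i using stretched_path_matrix_diag_pos[OF n that t] by simp
  have "gossip_condition_number (mat n n (\<lambda>(i, j). ?F i j)) = (2 * \<kappa>) / 2"
  proof (rule gossip_condition_numberI)
    have "2 \<in> spectrum ?L"
      unfolding specL using n linear_path_eigenvector[of n]
      by (intro exI[of _ "\<lambda>i. 2 * real i - (real n - 1)"]) (auto intro!: exI[of _ 0])
    from mapped[OF this] show "2 \<in> spectrum (mat n n (\<lambda>(i, j). ?F i j))" by simp
    from mapped[OF \<Lambda>[OF six]] show "2 * \<kappa> \<in> spectrum (mat n n (\<lambda>(i, j). ?F i j))" unfolding p\<Lambda> .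
    fix \<mu> assume "\<mu> \<in> spectrum (mat n n (\<lambda>(i, j). ?F i j))"
    then obtain y where y: "\<exists>i<n. y i \<noteq> 0"
      "\<forall>i<n. (1 - 2 * t) * path_laplacian n y i + t * path_laplacian n (path_laplacian n y) i = \<mu> * y i"
      unfolding spec by blast
    have "(\<Sum>i<n. y i * (\<Sum>j<n. ?F i j * y j)) = (\<Sum>i<n. \<mu> * (y i)\<^sup>2)"
      using y(2) by (intro sum.cong) (auto simp: stretched_path_matrix_sum power2_eq_square)
    then have "\<mu> * (\<Sum>i<n. (y i)\<^sup>2) = (\<Sum>i<n. y i * (\<Sum>j<n. ?F i j * y j))"
      by (simp add: sum_distrib_left)
    then have "0 \<le> \<mu> * (\<Sum>i<n. (y i)\<^sup>2)" using psd by simp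
    moreover obtain i0 where "i0 < n" "y i0 \<noteq> 0" using y(1) by blast
    then have "0 < (\<Sum>i<n. (y i)\<^sup>2)" by (intro sum_pos2[of _ i0]) auto
    ultimately have "0 \<le> \<mu>" by (simp add: zero_le_mult_iff)
    then obtain \<nu> where \<nu>: "\<nu> \<in> spectrum ?L" "\<mu> = \<nu> * (1 + t * (\<nu> - 2))"
      using stretched_path_eigenvalue[OF y(1) t _ y(2)] unfolding specL by blast
    show "\<mu> = 0 \<or> 2 \<le> \<mu> \<and> \<mu> \<le> 2 * \<kappa>"
    proof (cases "\<nu> = 0")
      case False
      then have l2: "2 \<le> \<nu>" and lL: "\<nu> \<le> \<Lambda>" using bounds(1) \<Lambda>max \<nu>(1) by auto
      have "2 * 1 \<le> \<mu>" unfolding \<nu>(2) using l2 t by (intro mult_mono) auto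
      moreover have "\<mu> \<le> \<Lambda> * (1 + t * (\<Lambda> - 2))"
        unfolding \<nu>(2) using l2 lL t by (intro mult_mono add_mono mult_left_mono) auto
      ultimately show ?thesis unfolding p\<Lambda> by simp
    qed (use \<nu>(2) in simp)
  qed simp
  then have "gossip_condition_number (mat n n (\<lambda>(i, j). ?F i j)) = \<kappa>" by simp
  then show ?thesis
    using gossip_matrixI[of ?F n, OF stretched_path_matrix_sym diag psd kernel] by blast
qed

text \<open>
  A condition number \<open>\<kappa>\<close> is realized on a row of nodes whose number is of the order of \<open>\<surd>\<kappa>\<close> at least and
  whose edges span at most two indices, so a vector needs at least this order of communication rounds
  from one end to the other.
\<close>

lemma exists_gossip_matrix:
  assumes "1 \<le> \<kappa>"
  shows "\<exists>n E W. 3 \<le> n \<and> simple_graph n E \<and> gossip_matrix n E W \<and> gossip_condition_number W = \<kappa> \<and>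
    (\<forall>(i, j)\<in>E. i \<le> j + 2 \<and> j \<le> i + 2) \<and> sqrt \<kappa> \<le> 4 * real n / 3"
proof (cases "\<kappa> < 9")
  case True
  have "sqrt \<kappa> \<le> sqrt (3\<^sup>2)" using True by (intro real_sqrt_le_mono) simp
  then have "sqrt \<kappa> \<le> 4 * real 3 / 3" by simp
  then show ?thesis using three_node_gossip[OF assms]
    by (intro exI[of _ 3] exI[of _ "sparsity_pattern 3 (three_node_gossip \<kappa>)"]
        exI[of _ "mat 3 3 (\<lambda>(i, j). three_node_gossip \<kappa> i j)"])
       (auto simp: sparsity_pattern_def)
next
  case False
  define n where "n = nat \<lfloor>sqrt \<kappa>\<rfloor>"
  have "sqrt (3\<^sup>2) \<le> sqrt \<kappa>" using False by (intro real_sqrt_le_mono) simp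
  then have s3: "3 \<le> sqrt \<kappa>" by simp
  then have n3: "3 \<le> n" unfolding n_def by linarith
  have n: "real n \<le> sqrt \<kappa>" "sqrt \<kappa> < real n + 1" unfolding n_def using s3 by linarith+
  have "(real n)\<^sup>2 \<le> (sqrt \<kappa>)\<^sup>2" using n(1) by (intro power_mono) auto
  then have "(real n)\<^sup>2 \<le> \<kappa>" using assms by simp
  then obtain t where t: "simple_graph n (sparsity_pattern n (stretched_path_matrix n t))"
    "gossip_matrix n (sparsity_pattern n (stretched_path_matrix n t))
       (mat n n (\<lambda>(i, j). stretched_path_matrix n t i j))"
    "gossip_condition_number (mat n n (\<lambda>(i, j). stretched_path_matrix n t i j)) = \<kappa>"
    using stretched_path_gossip[OF n3] by blast
  have "i \<le> j + 2 \<and> j \<le> i + 2" if "(i, j) \<in> sparsity_pattern n (stretched_path_matrix n t)" for i j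
    using that stretched_path_matrix_far[of i j n t] by (fastforce simp: sparsity_pattern_def)
  moreover have "sqrt \<kappa> \<le> 4 * real n / 3" using n(2) n3 by linarith
  ultimately show ?thesis using n3 t by blast
qed


section \<open>The hard instance\<close>

text \<open>
  The root \<open>q < 1\<close> of \<open>(\<tau> / 2) (1 - q)\<^sup>2 = q\<close>, the decay rate of the solutions of
  \<open>z\<^sub>j + (\<tau> / 2) (2 z\<^sub>j - z\<^sub>j\<^sub>-\<^sub>1 - z\<^sub>j\<^sub>+\<^sub>1) = 0\<close>. With \<open>q = exp (- 2 a)\<close> the equation reads
  \<open>sinh\<^sup>2 a = 1 / (2 \<tau>)\<close>.
\<close>

definition decay :: "real \<Rightarrow> real" where
  "decay \<tau> = exp (- 2 * arsinh (1 / sqrt (2 * \<tau>)))"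

lemma decay:
  assumes "0 < \<tau>"
  shows "0 < decay \<tau>" "decay \<tau> < 1" "\<tau> / 2 * (1 - decay \<tau>)\<^sup>2 = decay \<tau>" "- ln (decay \<tau>) \<le> sqrt (2 / \<tau>)"
proof -
  define a where "a = arsinh (1 / sqrt (2 * \<tau>))"
  have q: "decay \<tau> = exp (- a) * exp (- a)" by (simp add: decay_def a_def flip: exp_add)
  have sh: "sinh a = 1 / sqrt (2 * \<tau>)" by (simp add: a_def)
  have a: "0 < a" using assms by (simp add: a_def)
  then show "0 < decay \<tau>" "decay \<tau> < 1" by (simp_all add: decay_def a_def[symmetric])
  have "1 - decay \<tau> = exp (- a) * (2 * sinh a)"
    by (simp add: q sinh_field_def algebra_simps flip: exp_add)
  then have "(1 - decay \<tau>)\<^sup>2 = decay \<tau> * (4 * (sinh a)\<^sup>2)"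
    by (simp add: q power2_eq_square)
  also have "(sinh a)\<^sup>2 = 1 / (2 * \<tau>)" unfolding sh using assms by (simp add: power_divide)
  finally show "\<tau> / 2 * (1 - decay \<tau>)\<^sup>2 = decay \<tau>" using assms by simp
  have "a \<le> sinh a" using a real_le_x_sinh[of a] by (simp add: sinh_field_def exp_minus)
  then have "- ln (decay \<tau>) \<le> 2 * (1 / sqrt (2 * \<tau>))" unfolding decay_def a_def[symmetric] sh by simp
  also have "\<dots> = sqrt (2 / \<tau>)"
    using assms by (simp add: real_sqrt_mult real_sqrt_divide field_simps)
  finally show "- ln (decay \<tau>) \<le> sqrt (2 / \<tau>)" .
qed

text \<open>
  The coordinates of the sequence space are split into two chains: the coordinates \<open>2 j\<close> and the
  coordinates \<open>2 j + 1\<close>. The involutions \<open>left_link\<close> and \<open>right_link\<close> pair the positions of a chain into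
  \<open>{0, 1}, {2, 3}, \<dots>\<close> and \<open>{1, 2}, {3, 4}, \<dots>\<close>, so that only by alternating between them can one move
  along the chain.
\<close>

definition left_link :: "nat \<Rightarrow> nat" where
  "left_link j = (if even j then Suc j else j - 1)"

definition right_link :: "nat \<Rightarrow> nat" where
  "right_link j = (if j = 0 then 0 else if odd j then Suc j else j - 1)"

definition both_chains :: "(nat \<Rightarrow> nat) \<Rightarrow> nat \<Rightarrow> nat" where
  "both_chains l k = 2 * l (k div 2) + k mod 2"

definition odd_chain :: "(nat \<Rightarrow> nat) \<Rightarrow> nat \<Rightarrow> nat" where
  "odd_chain l k = (if odd k then both_chains l k else k)"

lemma both_chains_div_mod [simp]:
  "both_chains l k div 2 = l (k div 2)" "even (both_chains l k) = even k"
  unfolding both_chains_def by (simp, presburger)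

lemma both_chains_involution: "(\<And>j. l (l j) = j) \<Longrightarrow> both_chains l (both_chains l k) = k"
  unfolding both_chains_def by simp

lemma odd_chain_involution: "(\<And>j. l (l j) = j) \<Longrightarrow> odd_chain l (odd_chain l k) = k"
  unfolding odd_chain_def by (simp add: both_chains_involution)

text \<open>
  \<open>L\<close> and \<open>\<mu>\<close> are the smoothness and strong convexity constants and \<open>\<kappa>\<close> is the condition number of the
  constraint operators. The first \<open>m\<close> nodes use the left links and the last \<open>m\<close> nodes the right ones. The
  nodes between them only relay: their links are trivial, so their operators are scalars. They separate the
  two outer groups, but each group is a fixed fraction of the nodes and thus keeps its weight in
  averages over all nodes.
\<close>

locale hard_instance =
  fixes n :: nat and E :: "(nat \<times> nat) set" and L \<mu> \<kappa> :: real
  assumes n3: "3 \<le> n" and E2: "\<And>i j. (i, j) \<in> E \<Longrightarrow> i \<le> j + 2 \<and> j \<le> i + 2"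
    and \<mu>: "0 < \<mu>" and \<mu>L: "\<mu> < L" and \<kappa>: "1 \<le> \<kappa>"
begin

definition m :: nat where "m = n div 3"

definition link :: "nat \<Rightarrow> nat \<Rightarrow> nat" where
  "link i = (if i < m then left_link else if n - m \<le> i then right_link else id)"

abbreviation swap_all :: "nat \<Rightarrow> ell2 \<Rightarrow> ell2" where
  "swap_all i \<equiv> permute_coords (both_chains (link i))"

abbreviation swap_odd :: "nat \<Rightarrow> ell2 \<Rightarrow> ell2" where
  "swap_odd i \<equiv> permute_coords (odd_chain (link i))"

definition Q :: "nat \<Rightarrow> ell2 \<Rightarrow> ell2" where "Q i = split_op \<mu> L (swap_all i)"

definition Qinv :: "nat \<Rightarrow> ell2 \<Rightarrow> ell2" where "Qinv i = split_op (1 / \<mu>) (1 / L) (swap_all i)"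

definition A :: "nat \<Rightarrow> ell2 \<Rightarrow> ell2" where "A i = split_op (sqrt \<kappa>) 1 (swap_odd i)"

definition f :: "nat \<Rightarrow> ell2 \<Rightarrow> real" where "f i = quadratic (Q i)"

text \<open>
  At the outer nodes the operators \<open>A\<^sub>i Q\<^sub>i\<inverse> A\<^sub>i\<close>, whose sum is the Hessian of the dual problem, have the
  condition number \<open>cond k\<close> on the chain of the coordinate \<open>k\<close>: the large scalars \<open>1 / \<mu>\<close> and \<open>\<kappa>\<close> are
  attached to the same antisymmetric parts.
\<close>

definition cond :: "nat \<Rightarrow> real" where "cond k = (if odd k then L / \<mu> * \<kappa> else L / \<mu>)"

text \<open>
  On each chain, the average of these operators over all nodes is \<open>(1 / L) (I + (\<tau> / 2) \<Delta>)\<close>, where \<open>\<Delta>\<close> is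
  the positive Laplacian of the one-sided infinite path.
\<close>

definition \<tau> :: "nat \<Rightarrow> real" where "\<tau> k = real m / real n * (cond k - 1)"

text \<open>
  The dual solution, and the right-hand side which makes it one. The latter only occupies the first
  position of either chain.
\<close>

definition z :: ell2 where "z = Abs_ell2 (\<lambda>k. decay (\<tau> k) ^ (k div 2))"

definition b :: ell2 where
  "b = Abs_ell2 (\<lambda>k. if k < 2 then 1 / L * (1 + \<tau> k / 2 * (1 - decay (\<tau> k))) else 0)"

definition xopt :: "nat \<Rightarrow> ell2" where "xopt i = Qinv i (A i z)"

lemma m_bounds: "0 < m" "2 * m < n" "real n \<le> 5 * real m"
proof -
  show "0 < m" "2 * m < n" using n3 by (auto simp: m_def)
  have "n \<le> 5 * m" using n3 unfolding m_def by presburger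
  then show "real n \<le> 5 * real m" by simp
qed

lemma L_pos: "0 < L" using \<mu> \<mu>L by simp

lemma link_involution: "link i (link i j) = j"
  by (auto simp: link_def left_link_def right_link_def)

lemma le_link: "j \<le> Suc (link i j)"
  by (auto simp: link_def left_link_def right_link_def)

lemma link_middle: "link m = id"
  using m_bounds by (auto simp: link_def)

lemmas swap_all_involution = both_chains_involution[OF link_involution]
lemmas swap_odd_involution = odd_chain_involution[OF link_involution]
lemmas reflection_swap_all = reflection_permute_coords[OF swap_all_involution]
lemmas reflection_swap_odd = reflection_permute_coords[OF swap_odd_involution]

lemma bounded_linear_ops: "bounded_linear (Q i)" "bounded_linear (Qinv i)" "bounded_linear (A i)"
  unfolding Q_def Qinv_def A_def
  by (intro bounded_linear_split_op reflection_swap_all reflection_swap_odd)+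

lemma selfadjoint_ops: "inner (Q i x) y = inner x (Q i y)" "inner (Qinv i x) y = inner x (Qinv i y)"
  "inner (A i x) y = inner x (A i y)"
  unfolding Q_def Qinv_def A_def
  by (intro split_op_inner reflection_swap_all reflection_swap_odd)+

lemma Q_Qinv: "Q i (Qinv i x) = x"
  unfolding Q_def Qinv_def using \<mu> L_pos
  by (simp add: split_op_compose[OF reflection_swap_all] split_op_one[OF reflection_swap_all])

lemma Q_bounds: "\<mu> * (norm x)\<^sup>2 \<le> inner (Q i x) x" "inner (Q i x) x \<le> L * (norm x)\<^sup>2"
  unfolding Q_def using \<mu>L
  by (auto intro!: split_op_lower split_op_upper reflection_swap_all)

lemma Q_nonneg: "0 \<le> inner (Q i x) x"
  using Q_bounds(1)[of x i] \<mu> by (smt (verit) zero_le_mult_iff zero_le_power2)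

lemma smooth_strongly_convex_f: "smooth_strongly_convex L \<mu> (f i)"
  unfolding f_def
  by (intro smooth_strongly_convex_quadratic bounded_linear_ops selfadjoint_ops Q_bounds)

lemma grad_f: "grad (f i) = Q i"
  unfolding f_def by (intro grad_quadratic bounded_linear_ops selfadjoint_ops)

lemma grad_conjugate_f: "grad (fenchel_conjugate (f i)) = Qinv i"
proof -
  have "fenchel_conjugate (f i) = quadratic (Qinv i)"
    unfolding f_def
    by (intro fenchel_conjugate_quadratic bounded_linear_ops selfadjoint_ops Q_Qinv Q_nonneg)
  then show ?thesis by (simp add: grad_quadratic[OF bounded_linear_ops(2) selfadjoint_ops(2)])
qed

lemma adjoint_A: "adjoint (A i) = A i"
  unfolding A_def by (intro adjoint_split_op reflection_swap_odd)


subsection \<open>The constants of the constraint operators\<close>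

lemma A_A: "A i (A i x) = split_op \<kappa> 1 (swap_odd i) x"
  unfolding A_def using \<kappa> by (simp add: split_op_compose[OF reflection_swap_odd])

definition unit0 :: ell2 where "unit0 = Abs_ell2 (\<lambda>k. if k = 0 then 1 else 0)"

lemma coord_unit0: "ell2_coord unit0 k = (if k = 0 then 1 else 0)"
proof -
  have "summable (\<lambda>k. (if k = (0::nat) then 1 else 0 :: real)\<^sup>2)"
    by (rule summable_finite[of "{0}"]) auto
  then show ?thesis unfolding unit0_def by (subst Abs_ell2_inverse) auto
qed

lemma unit0_nonzero: "unit0 \<noteq> 0"
  using coord_unit0[of 0] by (auto simp: coord_simps)

text \<open>The constraint operators act as the identity on the even chain.\<close>

lemma A_unit0: "A i unit0 = unit0"
proof (rule ell2_eqI)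
  fix k
  have "(odd_chain (link i) k = 0) = (k = 0)"
    by (metis odd_chain_def even_zero swap_odd_involution)
  then show "ell2_coord (A i unit0) k = ell2_coord unit0 k"
    unfolding A_def by (simp add: coord_split_permute[OF swap_odd_involution] coord_unit0)
qed

lemma sigma_max_A: "(sigma_max (A i))\<^sup>2 \<le> \<kappa>"
proof -
  have AA: "adjoint (A i) \<circ> A i = split_op \<kappa> 1 (swap_odd i)"
    by (simp add: fun_eq_iff adjoint_A A_A)
  have sub: "op_spectrum (adjoint (A i) \<circ> A i) \<subseteq> {\<kappa>, 1}"
    unfolding AA by (rule op_spectrum_split_op[OF reflection_swap_odd])
  have one: "1 \<in> op_spectrum (adjoint (A i) \<circ> A i)"
    by (rule eigenvalue_in_op_spectrum[OF _ unit0_nonzero]) (simp add: adjoint_A A_unit0)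
  have "Sup (op_spectrum (adjoint (A i) \<circ> A i)) \<le> \<kappa>"
    by (rule cSup_least) (use sub one \<kappa> in auto)
  moreover have "1 \<le> Sup (op_spectrum (adjoint (A i) \<circ> A i))"
    by (rule cSup_upper[OF one]) (rule bdd_above_mono[OF _ sub], simp)
  ultimately show ?thesis unfolding sigma_max_def by simp
qed

lemma gram_mean_unit0: "gram_mean n A unit0 = unit0"
  using n3 by (simp add: gram_mean_def adjoint_A A_unit0 scaleR_conv_of_real sum_constant_scaleR)

lemma bounded_linear_gram_mean: "bounded_linear (gram_mean n A)"
  unfolding gram_mean_def[abs_def] adjoint_A
  by (intro bounded_linear_compose[OF bounded_linear_scaleR_right] bounded_linear_sum
      bounded_linear_compose[OF bounded_linear_ops(3)] bounded_linear_ops)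

lemma gram_mean_coercive: "1 * (norm x)\<^sup>2 \<le> inner (gram_mean n A x) x"
proof -
  have "real n * (norm x)\<^sup>2 = (\<Sum>i<n. 1 * (norm x)\<^sup>2)" by simp
  also have "\<dots> \<le> (\<Sum>i<n. inner (A i (A i x)) x)"
    unfolding A_A using \<kappa> by (intro sum_mono split_op_lower reflection_swap_odd) auto
  finally show ?thesis
    using n3 by (simp add: gram_mean_def adjoint_A inner_sum_left field_simps)
qed

lemma constraint_constants_A: "constraint_constants n A \<kappa> 1"
proof -
  have one: "1 \<in> op_spectrum (gram_mean n A)"
    by (rule eigenvalue_in_op_spectrum[OF _ unit0_nonzero]) (simp add: gram_mean_unit0)
  have "1 \<le> lambda_min_pos (gram_mean n A)"
    unfolding lambda_min_pos_def
  proof (rule cInf_greatest)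
    show "op_spectrum (gram_mean n A) - {0} \<noteq> {}" using one by auto
    show "1 \<le> r" if "r \<in> op_spectrum (gram_mean n A) - {0}" for r
      using that coercive_imp_not_in_spectrum[OF bounded_linear_gram_mean _ gram_mean_coercive, of r]
      by fastforce
  qed
  moreover have "gram_mean n A \<noteq> (\<lambda>_. 0)" using gram_mean_unit0 unit0_nonzero by metis
  moreover have "(MAX i\<in>{..<n}. (sigma_max (A i))\<^sup>2) \<le> \<kappa>"
    using n3 by (subst Max_le_iff) (auto simp: sigma_max_A lessThan_empty_iff)
  ultimately show ?thesis using \<kappa> by (simp add: constraint_constants_def)
qed


subsection \<open>The solution\<close>

lemma cond_gt: "1 < L / \<mu>" "L / \<mu> \<le> cond k" "1 < cond k" "1 / (L / \<mu>) \<le> 1"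
proof -
  show "1 / (L / \<mu>) \<le> 1" using \<mu> \<mu>L by simp
  show 1: "1 < L / \<mu>" using \<mu> \<mu>L by simp
  show 2: "L / \<mu> \<le> cond k" unfolding cond_def using 1 \<kappa> mult_left_mono[of 1 \<kappa> "L / \<mu>"] by simp
  show "1 < cond k" using 1 2 by linarith
qed

lemma sqrt_cond_odd: "sqrt (cond (2 * j + 1)) = sqrt (L / \<mu>) * sqrt \<kappa>"
  by (simp add: cond_def flip: real_sqrt_mult)

lemma \<tau>_pos: "0 < \<tau> k"
  unfolding \<tau>_def using cond_gt(3)[of k] m_bounds by simp

lemmas decay_\<tau> = decay[OF \<tau>_pos]

lemma \<tau>_parity: "even k = even k' \<Longrightarrow> \<tau> k = \<tau> k'"
  by (simp add: \<tau>_def cond_def)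

lemma coord_z: "ell2_coord z k = decay (\<tau> k) ^ (k div 2)"
proof -
  define r where "r = max (decay (\<tau> 0)) (decay (\<tau> 1))"
  have r: "0 < r" "r < 1" using decay_\<tau>(1,2) unfolding r_def by (auto simp: max_def)
  have dr: "decay (\<tau> k) \<le> r" for k
    using \<tau>_parity[of k 0] \<tau>_parity[of k 1] unfolding r_def by (cases "even k") (auto simp: max_def)
  have "summable (\<lambda>k. (decay (\<tau> k) ^ (k div 2))\<^sup>2)"
  proof (rule summable_comparison_test'[where N = 0])
    show "summable (\<lambda>k. 1 / r * r ^ k)" using r by (intro summable_mult summable_geometric) simp
    fix k
    have "(decay (\<tau> k) ^ (k div 2))\<^sup>2 = decay (\<tau> k) ^ (2 * (k div 2))" by (simp flip: power_mult add: mult.commute)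
    also have "\<dots> \<le> r ^ (2 * (k div 2))" using dr decay_\<tau>(1) by (intro power_mono) (auto intro: less_imp_le)
    also have "\<dots> \<le> 1 / r * r ^ k"
    proof -
      have "r ^ Suc (2 * (k div 2)) \<le> r ^ k" using r by (intro power_decreasing) auto
      then show ?thesis using r by (simp add: field_simps)
    qed
    finally show "norm ((decay (\<tau> k) ^ (k div 2))\<^sup>2) \<le> 1 / r * r ^ k" by simp
  qed
  then show ?thesis unfolding z_def by (subst Abs_ell2_inverse) auto
qed

lemma coord_b: "ell2_coord b k = (if k < 2 then 1 / L * (1 + \<tau> k / 2 * (1 - decay (\<tau> k))) else 0)"
proof -
  have "summable (\<lambda>k. (if k < 2 then 1 / L * (1 + \<tau> k / 2 * (1 - decay (\<tau> k))) else 0)\<^sup>2)"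
    by (rule summable_finite[of "{..<2}"]) auto
  then show ?thesis unfolding b_def by (subst Abs_ell2_inverse) auto
qed

lemma coord_dual_hessian:
  fixes k i defines "k' \<equiv> both_chains (link i) k"
  shows "ell2_coord (A i (Qinv i (A i x))) k =
    1 / L * (ell2_coord x k + (cond k - 1) / 2 * (ell2_coord x k - ell2_coord x k'))"
proof -
  define u w where "u = (ell2_coord x k - ell2_coord x k') / 2" and "w = (ell2_coord x k + ell2_coord x k') / 2"
  have partner: "both_chains (link i) k' = k" unfolding k'_def by (rule swap_all_involution)
  have par: "even k' = even k" unfolding k'_def by simp
  have x: "ell2_coord x k = w + u" "ell2_coord x k' = w - u" by (simp_all add: u_def w_def field_simps)
  have all: "ell2_coord (Qinv i y) k = 1 / L * w + 1 / \<mu> * u" "ell2_coord (Qinv i y) k' = 1 / L * w - 1 / \<mu> * u"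
    if "ell2_coord y k = w + u" "ell2_coord y k' = w - u" for y w u
    unfolding Qinv_def coord_split_permute[OF swap_all_involution] partner k'_def[symmetric]
    by (simp_all add: that algebra_simps)
  show ?thesis
  proof (cases "odd k")
    case True
    have A: "ell2_coord (A i y) k = w + sqrt \<kappa> * u" "ell2_coord (A i y) k' = w - sqrt \<kappa> * u"
      if "ell2_coord y k = w + u" "ell2_coord y k' = w - u" for y w u
    proof -
      have o: "odd_chain (link i) k = k'" "odd_chain (link i) k' = k"
        using True par partner by (simp_all add: odd_chain_def k'_def)
      show "ell2_coord (A i y) k = w + sqrt \<kappa> * u" "ell2_coord (A i y) k' = w - sqrt \<kappa> * u"
        unfolding A_def coord_split_permute[OF swap_odd_involution] o
        by (simp_all add: that algebra_simps)
    qed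
    have "ell2_coord (A i (Qinv i (A i x))) k = 1 / L * w + sqrt \<kappa> * (1 / \<mu> * (sqrt \<kappa> * u))"
      by (intro A(1) all A x)
    also have "\<dots> = 1 / L * w + \<kappa> / \<mu> * u" using \<kappa> by simp
    also have "\<dots> = 1 / L * (w + cond k * u)" using True L_pos by (simp add: cond_def field_simps)
    also have "w + cond k * u = ell2_coord x k + (cond k - 1) / 2 * (ell2_coord x k - ell2_coord x k')"
      unfolding x by (simp add: field_simps)
    finally show ?thesis .
  next
    case False
    have A: "ell2_coord (A i y) k = ell2_coord y k" "ell2_coord (A i y) k' = ell2_coord y k'" for y
    proof -
      have o: "odd_chain (link i) k = k" "odd_chain (link i) k' = k'"
        using False par by (simp_all add: odd_chain_def)
      show "ell2_coord (A i y) k = ell2_coord y k" "ell2_coord (A i y) k' = ell2_coord y k'"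
        unfolding A_def coord_split_permute[OF swap_odd_involution] o by simp_all
    qed
    have "ell2_coord (A i (Qinv i (A i x))) k = 1 / L * w + 1 / \<mu> * u"
      unfolding A by (intro all) (simp_all add: A x)
    also have "\<dots> = 1 / L * (w + cond k * u)" using False L_pos by (simp add: cond_def field_simps)
    also have "w + cond k * u = ell2_coord x k + (cond k - 1) / 2 * (ell2_coord x k - ell2_coord x k')"
      unfolding x by (simp add: field_simps)
    finally show ?thesis .
  qed
qed

lemma sum_over_nodes:
  fixes g :: "(nat \<Rightarrow> nat) \<Rightarrow> real"
  shows "(\<Sum>i<n. g (link i)) = real m * g left_link + real m * g right_link + (real n - 2 * real m) * g id"
proof -
  have "(\<Sum>i<n. g (link i)) = (\<Sum>i=0..<m. g (link i)) + (\<Sum>i=m..<n-m. g (link i)) + (\<Sum>i=n-m..<n. g (link i))"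
    using m_bounds by (simp add: lessThan_atLeast0 sum.atLeastLessThan_concat)
  also have "(\<Sum>i=0..<m. g (link i)) = (\<Sum>i=0..<m. g left_link)"
    by (intro sum.cong) (auto simp: link_def)
  also have "(\<Sum>i=m..<n-m. g (link i)) = (\<Sum>i=m..<n-m. g id)"
    by (intro sum.cong) (auto simp: link_def)
  also have "(\<Sum>i=n-m..<n. g (link i)) = (\<Sum>i=n-m..<n. g right_link)"
    using m_bounds by (intro sum.cong) (auto simp: link_def)
  finally show ?thesis using m_bounds by (simp add: of_nat_diff id_def)
qed

text \<open>
  On each chain the left and the right links together make up the path, so the dual optimality
  condition is a tridiagonal recursion whose decaying solution is geometric.
\<close>

lemma dual_optimality: "(\<Sum>i<n. A i (Qinv i (A i z))) = (\<Sum>i<n. b)"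
proof (rule ell2_eqI)
  fix k
  define q j where "q = decay (\<tau> k)" and "j = k div 2"
  have zl: "ell2_coord z (both_chains l k) = q ^ l j" for l
    unfolding coord_z q_def j_def using \<tau>_parity[of "both_chains l k" k] by simp
  have zk: "ell2_coord z k = q ^ j" by (simp add: coord_z q_def j_def)
  define g where "g l = 1 / L * (q ^ j + (cond k - 1) / 2 * (q ^ j - q ^ l j))" for l
  have "ell2_coord (\<Sum>i<n. A i (Qinv i (A i z))) k = (\<Sum>i<n. g (link i))"
    by (simp only: coord_sum coord_dual_hessian zl zk g_def)
  also have "\<dots> = real m * g left_link + real m * g right_link + (real n - 2 * real m) * g id"
    by (rule sum_over_nodes)
  also have "\<dots> = real n / L * (q ^ j + \<tau> k / 2 * (2 * q ^ j - (q ^ left_link j + q ^ right_link j)))"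
    unfolding g_def \<tau>_def using L_pos n3 by (simp add: field_simps)
  also have "\<dots> = real n * ell2_coord b k"
  proof (cases j)
    case 0
    then have "k < 2" by (auto simp: j_def)
    then show ?thesis using 0 by (simp add: coord_b left_link_def right_link_def q_def)
  next
    case (Suc j')
    then have "\<not> k < 2" by (auto simp: j_def)
    have "q ^ left_link j + q ^ right_link j = q ^ j' * (1 + q\<^sup>2)"
      using Suc by (simp add: left_link_def right_link_def power2_eq_square algebra_simps)
    then have "q ^ j + \<tau> k / 2 * (2 * q ^ j - (q ^ left_link j + q ^ right_link j))
        = q ^ j' * (q - \<tau> k / 2 * (1 - q)\<^sup>2)"
      using Suc by (simp add: power2_eq_square algebra_simps)
    also have "\<dots> = 0" using decay_\<tau>(3)[of k] by (simp add: q_def)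
    finally show ?thesis using \<open>\<not> k < 2\<close> by (simp add: coord_b)
  qed
  also have "\<dots> = ell2_coord (\<Sum>i<n. b) k" by (simp add: coord_sum)
  finally show "ell2_coord (\<Sum>i<n. A i (Qinv i (A i z))) k = ell2_coord (\<Sum>i<n. b) k" .
qed

lemma is_solution_xopt: "is_solution n f A (\<lambda>_. b) xopt"
  unfolding is_solution_def
proof (intro conjI allI impI)
  show feas: "feasible n A (\<lambda>_. b) xopt"
    unfolding feasible_def xopt_def sum_subtractf dual_optimality by simp
  fix y assume y: "feasible n A (\<lambda>_. b) y"
  have *: "inner z (A i (y i) - b) - inner z (A i (xopt i) - b) \<le> f i (y i) - f i (xopt i)" for i
  proof -
    have "f i (y i) - f i (xopt i) - inner (Q i (xopt i)) (y i - xopt i) = f i (y i - xopt i)"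
      unfolding f_def by (rule quadratic_expand[OF bounded_linear_ops(1) selfadjoint_ops(1)])
    moreover have "0 \<le> f i (y i - xopt i)" using Q_nonneg by (simp add: f_def quadratic_def)
    moreover have "inner (Q i (xopt i)) (y i - xopt i) = inner z (A i (y i) - A i (xopt i))"
      by (simp add: xopt_def Q_Qinv selfadjoint_ops(3)
          linear_diff[OF bounded_linear.linear[OF bounded_linear_ops(3)]])
    ultimately show ?thesis by (simp add: inner_diff_right)
  qed
  have "(\<Sum>i<n. inner z (A i (y i) - b)) - (\<Sum>i<n. inner z (A i (xopt i) - b)) = 0"
    using y feas by (simp add: feasible_def flip: inner_sum_right)
  moreover have "(\<Sum>i<n. inner z (A i (y i) - b) - inner z (A i (xopt i) - b)) \<le> (\<Sum>i<n. f i (y i) - f i (xopt i))"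
    by (intro sum_mono *)
  ultimately have "0 \<le> (\<Sum>i<n. f i (y i)) - (\<Sum>i<n. f i (xopt i))" by (simp add: sum_subtractf)
  then show "(\<Sum>i<n. f i (xopt i)) \<le> (\<Sum>i<n. f i (y i))" by simp
qed


subsection \<open>Lower bounds on the numbers of rounds\<close>

lemma coordinates_confined:
  fixes S T :: "nat \<Rightarrow> nat \<Rightarrow> nat set" and r :: round
  assumes mono: "\<And>c s i. S c i \<subseteq> S (advance r s c) i" "\<And>c s i. T c i \<subseteq> T (advance r s c) i"
    and grad: "\<And>c i k. both_chains (link i) k \<in> S c i \<Longrightarrow> k \<in> S (advance r Gradient_Round c) i"
    and multS: "\<And>c i k. k \<in> T c i \<or> odd_chain (link i) k \<in> T c i \<Longrightarrow> k \<in> S (advance r Multiplication_Round c) i"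
    and multT: "\<And>c i k. k \<in> S c i \<or> odd_chain (link i) k \<in> S c i \<Longrightarrow> k \<in> T (advance r Multiplication_Round c) i"
    and multb: "\<And>c i k. k < 2 \<Longrightarrow> k \<in> T (advance r Multiplication_Round c) i"
      "\<And>c i k. k < 2 \<or> odd_chain (link i) k < 2 \<Longrightarrow> k \<in> S (advance r Multiplication_Round c) i"
    and comm: "\<And>c i j. (i, j) \<in> E \<Longrightarrow> T c j \<subseteq> T (advance r Communication_Round c) i"
    and x: "x \<in> fst (memory_after f A (\<lambda>_. b) E rs) i" and k: "k \<notin> S (count_list rs r) i"
  shows "ell2_coord x k = 0"
proof -
  have b: "b \<in> supported_on {..<2}" by (simp add: supported_on_def coord_b)
  have "fst (memory_after f A (\<lambda>_. b) E rs) i \<subseteq> supported_on (S (count_list rs r) i) \<and>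
        snd (memory_after f A (\<lambda>_. b) E rs) i \<subseteq> supported_on (T (count_list rs r) i)"
  proof (rule memory_confined[where U = "\<lambda>c i. supported_on (S c i)" and V = "\<lambda>c i. supported_on (T c i)"])
    show "x \<in> supported_on (S (advance r Gradient_Round c) i) \<and>
          grad (f i) x \<in> supported_on (S (advance r Gradient_Round c) i) \<and>
          grad (fenchel_conjugate (f i)) x \<in> supported_on (S (advance r Gradient_Round c) i)"
      if "x \<in> supported_on (S c i)" for c i x
      unfolding grad_f grad_conjugate_f Q_def Qinv_def
      by (intro conjI split_permute_supported_on[OF swap_all_involution that mono(1)]
          supported_on_mono[OF mono(1) that]) (erule grad)+
    show "adjoint (A i) y \<in> supported_on (S (advance r Multiplication_Round c) i)" if "y \<in> supported_on (T c i)" for c i y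
      unfolding adjoint_A unfolding A_def
      by (rule split_permute_supported_on[OF swap_odd_involution that]) (use multS in auto)
    show "adjoint (A i) b \<in> supported_on (S (advance r Multiplication_Round c) i)" for c i
      unfolding adjoint_A unfolding A_def
      by (rule split_permute_supported_on[OF swap_odd_involution b]) (use multb in auto)
    show "A i x \<in> supported_on (T (advance r Multiplication_Round c) i)" if "x \<in> supported_on (S c i)" for c i x
      unfolding A_def
      by (rule split_permute_supported_on[OF swap_odd_involution that]) (use multT in auto)
    show "b \<in> supported_on (T (advance r Multiplication_Round c) i)" for c i
      by (rule supported_on_mono[OF _ b]) (use multb in auto)
    show "supported_on (T c j) \<subseteq> supported_on (T (advance r Communication_Round c) i)" if "(i, j) \<in> E" for c i j
      using supported_on_mono[OF comm[OF that]] by blast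
    show "supported_on (T c i) \<subseteq> supported_on (T (advance r Gradient_Round c) i)" for c i
      using supported_on_mono[OF mono(2)] by blast
    show "supported_on (S c i) \<subseteq> supported_on (S (advance r Communication_Round c) i)" for c i
      using supported_on_mono[OF mono(1)] by blast
  qed (rule subspace_supported_on)+
  then show ?thesis using x k by (auto simp: supported_on_def)
qed

text \<open>
  On the even chain only gradients move along the links, because the constraint operators act as the
  identity there. Each gradient computation reaches at most one more position.
\<close>

lemma gradient_frontier:
  assumes "x \<in> fst (memory_after f A (\<lambda>_. b) E rs) i"
  shows "ell2_coord x (2 * Suc (count_list rs Gradient_Round)) = 0"
proof -
  define S :: "nat \<Rightarrow> nat \<Rightarrow> nat set" where "S c i = {k. odd k \<or> k div 2 \<le> c}" for c i
  have oc: "odd_chain (link i) k \<in> S c i' \<longleftrightarrow> k \<in> S c i'" for i k c i'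
    by (auto simp: advance_def S_def odd_chain_def)
  show ?thesis
  proof (rule coordinates_confined[where S = S and T = S and r = Gradient_Round, OF _ _ _ _ _ _ _ _ assms])
    show "k \<in> S (advance Gradient_Round Gradient_Round c) i"
      if "both_chains (link i) k \<in> S c i" for c i k
      using that le_link[of "k div 2" i] by (auto simp: advance_def S_def)
    show "k \<in> S (advance Gradient_Round Multiplication_Round c) i"
      if "k < 2 \<or> odd_chain (link i) k < 2" for c i k
      using that oc[of i k 0 i] by (auto simp: advance_def S_def odd_chain_def)
  qed (auto simp: advance_def S_def odd_chain_def)
qed

text \<open>
  On the odd chain a node can move along its own links for free, but then it has to exchange vectors
  with a node of the other kind to move on, which takes a multiplication. The local memory may
  therefore be ahead of the shared one by one link.
\<close>

lemma multiplication_frontier: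
  assumes "x \<in> fst (memory_after f A (\<lambda>_. b) E rs) m"
  shows "ell2_coord x (2 * count_list rs Multiplication_Round + 1) = 0"
proof -
  define S T :: "nat \<Rightarrow> nat \<Rightarrow> nat set"
    where "S c i = {k. even k \<or> k div 2 < c \<or> link i (k div 2) < c}" and "T c i = {k. even k \<or> k div 2 < c}" for c i
  show ?thesis
  proof (rule coordinates_confined[where S = S and T = T and r = Multiplication_Round, OF _ _ _ _ _ _ _ _ assms])
    show "k \<in> S (advance Multiplication_Round Gradient_Round c) i"
      if "both_chains (link i) k \<in> S c i" for c i k
      using that by (auto simp: advance_def S_def link_involution)
    show "k \<in> S (advance Multiplication_Round Multiplication_Round c) i"
      if "k \<in> T c i \<or> odd_chain (link i) k \<in> T c i" for c i k
      using that by (auto simp: advance_def S_def T_def odd_chain_def split: if_splits)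
    show "k \<in> T (advance Multiplication_Round Multiplication_Round c) i"
      if "k \<in> S c i \<or> odd_chain (link i) k \<in> S c i" for c i k
      using that le_link[of "k div 2" i]
      by (auto simp: advance_def S_def T_def odd_chain_def link_involution split: if_splits)
    show "k \<in> S (advance Multiplication_Round Multiplication_Round c) i"
      if "k < 2 \<or> odd_chain (link i) k < 2" for c i k
    proof -
      have "link i (k div 2) = 0" if "both_chains (link i) k < 2"
        using that by (metis both_chains_div_mod(1) div_less)
      then show ?thesis using that by (auto simp: advance_def S_def odd_chain_def split: if_splits)
    qed
  qed (auto simp: advance_def S_def T_def link_middle)
qed

text \<open>
  Every communication round carries a vector over at most two indices, so at least \<open>D\<close> of them are needed
  between the two outer groups, and at least \<open>travel i\<close> between the left group and node \<open>i\<close>. Capping the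
  travel time at \<open>D\<close> makes it constant on the right group.
\<close>

definition D :: nat where "D = (n - 2 * m + 1) div 2"

definition travel :: "nat \<Rightarrow> nat" where "travel i = min D ((i + 1 - m) div 2)"

lemma travel_left: "i < m \<Longrightarrow> travel i = 0"
  by (simp add: travel_def)

lemma travel_right: "n - m \<le> i \<Longrightarrow> travel i = D"
proof -
  assume "n - m \<le> i"
  then have "n - 2 * m + 1 \<le> i + 1 - m" using m_bounds by linarith
  then have "D \<le> (i + 1 - m) div 2" unfolding D_def by (rule div_le_mono)
  then show "travel i = D" by (simp add: travel_def)
qed

lemma travel_edge: "(i, j) \<in> E \<Longrightarrow> travel i \<le> Suc (travel j)" "(i, j) \<in> E \<Longrightarrow> travel j \<le> Suc (travel i)"
proof -
  have *: "travel i \<le> Suc (travel j)" if "i \<le> j + 2" for i j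
  proof -
    have "(i + 1 - m) div 2 \<le> Suc (Suc (j + 1 - m)) div 2" using that by (intro div_le_mono) linarith
    then show ?thesis by (auto simp: travel_def min_def)
  qed
  show "(i, j) \<in> E \<Longrightarrow> travel i \<le> Suc (travel j)" "(i, j) \<in> E \<Longrightarrow> travel j \<le> Suc (travel i)"
    using E2 * by blast+
qed

lemma travel_le: "travel i \<le> D" by (simp add: travel_def)

lemma D_bounds: "0 < D" "real n \<le> 6 * real D"
proof -
  have m3: "3 * m \<le> n" by (simp add: m_def)
  show "0 < D" using m_bounds unfolding D_def by linarith
  have "n \<le> 6 * D" using m3 m_bounds(2) unfolding D_def by linarith
  then show "real n \<le> 6 * real D" by simp
qed

text \<open>
  Position \<open>j\<close> of the odd chain is reached from position \<open>j - 1\<close> in the left group for odd \<open>j\<close> and in the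
  right group for even \<open>j > 0\<close>. It is thus available at node \<open>i\<close> only after \<open>(j - 1) D\<close> communication rounds
  plus the travel time to \<open>i\<close> from the group in which it appears; \<open>delay\<close> below is this time plus \<open>D\<close>.
  In either outer group, linked positions have the same delay, so local computations do not shorten it.
\<close>

lemma communication_frontier:
  assumes "x \<in> fst (memory_after f A (\<lambda>_. b) E rs) i"
  shows "ell2_coord x (2 * (count_list rs Communication_Round div D + 2) + 1) = 0"
proof -
  define delay where "delay i j = j * D + (if odd j then travel i else D - travel i)" for i j
  define S :: "nat \<Rightarrow> nat \<Rightarrow> nat set" where "S c i = {k. even k \<or> delay i (k div 2) \<le> c + D}" for c i
  have delay_link: "delay i (link i j) = delay i j" for i j
  proof -
    have [simp]: "j * D = (j - 1) * D + D" if "0 < j" for j using that by (cases j) auto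
    have "link i = id" if "\<not> i < m" "\<not> n - m \<le> i" using that by (simp add: link_def)
    then consider "i < m" | "n - m \<le> i" "\<not> i < m" | "link i = id" by blast
    then show ?thesis
    proof cases
      case 1
      then show ?thesis using travel_left[OF 1]
        by (auto simp: delay_def link_def left_link_def elim!: oddE)
    next
      case 2
      then show ?thesis using travel_right[OF 2(1)]
        by (auto simp: delay_def link_def right_link_def elim!: oddE evenE)
    qed simp
  qed
  have delay_edge: "delay i j \<le> Suc (delay i' j)" if "(i, i') \<in> E" for i i' j
    using travel_edge[OF that] by (auto simp: delay_def)
  have closed: "odd_chain (link i) k \<in> S c i \<longleftrightarrow> k \<in> S c i" "both_chains (link i) k \<in> S c i \<longleftrightarrow> k \<in> S c i" for i k c
    by (auto simp: advance_def S_def odd_chain_def delay_link)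
  have start: "k \<in> S c i" if "k < 2" for k c i
    using that by (auto simp: advance_def S_def delay_def)
  have mono: "S c i \<subseteq> S (Suc c) i" for c i by (auto simp: advance_def S_def)
  show ?thesis
  proof (rule coordinates_confined[where S = S and T = S and r = Communication_Round, OF _ _ _ _ _ _ _ _ assms])
    show "S c j \<subseteq> S (advance Communication_Round Communication_Round c) i" if "(i, j) \<in> E" for c i j
    proof
      fix k assume "k \<in> S c j"
      then show "k \<in> S (advance Communication_Round Communication_Round c) i"
        using delay_edge[OF that, of "k div 2"] by (auto simp: advance_def S_def)
    qed
    show "k \<in> S (advance Communication_Round Multiplication_Round c) i"
      if "k < 2 \<or> odd_chain (link i) k < 2" for c i k
      using that start closed(1)[of i k c] by (auto simp: advance_def)
    show "2 * (count_list rs Communication_Round div D + 2) + 1 \<notin> S (count_list rs Communication_Round) i"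
    proof -
      let ?N = "count_list rs Communication_Round"
      have "?N < (?N div D) * D + D" 
        using D_bounds(1) mod_less_divisor[of D ?N] div_mult_mod_eq[of ?N D] by linarith
      then have "?N + D < (?N div D + 2) * D" by (simp add: algebra_simps)
      then show ?thesis by (simp add: S_def delay_def)
    qed
  qed (use mono start in \<open>auto simp: advance_def closed\<close>)
qed

text \<open>
  At the relay node \<open>m\<close> the solution is \<open>z / L\<close>, so a single coordinate that has not been reached there
  forces an error that is geometric in its position.
\<close>

lemma error_lower_bound:
  assumes acc: "reaches_accuracy n f A (\<lambda>_. b) E xopt \<epsilon> rs x" and x: "ell2_coord (x m) k = 0"
  shows "(decay (\<tau> k) ^ (k div 2) / L)\<^sup>2 \<le> \<epsilon>"
proof -
  have id: "both_chains id = id" by (rule ext) (simp only: both_chains_def id_apply mult_div_mod_eq)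
  then have "odd_chain id = id" by (simp add: odd_chain_def fun_eq_iff)
  then have "ell2_coord (xopt m) k = ell2_coord z k / L"
    using id coord_split_permute[of id] by (simp add: xopt_def Qinv_def A_def link_middle)
  then have "(decay (\<tau> k) ^ (k div 2) / L)\<^sup>2 = (ell2_coord (x m - xopt m) k)\<^sup>2"
    by (simp add: coord_simps x coord_z)
  also have "\<dots> \<le> (norm (x m - xopt m))\<^sup>2"
    using abs_coord_le_norm[of "x m - xopt m" k] by (metis abs_norm_cancel abs_le_square_iff)
  also have "\<dots> \<le> (\<Sum>i<n. (norm (x i - xopt i))\<^sup>2)"
    using m_bounds by (intro member_le_sum) auto
  also have "\<dots> \<le> \<epsilon>" using acc by (simp add: reaches_accuracy_def)
  finally show ?thesis .
qed

text \<open>The fourth power of the decay rate accounts for up to two positions that come for free.\<close>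

definition C :: real where "C = ((min (decay (\<tau> 0)) (decay (\<tau> 1)))\<^sup>2 / L)\<^sup>2"

lemma C_pos: "0 < C"
  unfolding C_def using decay_\<tau>(1)[of 0] decay_\<tau>(1)[of 1] L_pos
  by (intro zero_less_power divide_pos_pos) simp_all

text \<open>
  \<open>N\<close> is the number of links that have been passed. Since \<open>- ln (decay \<tau>) \<le> \<surd>(2 / \<tau>)\<close>, each of them
  improves \<open>ln (C / \<epsilon>)\<close> by at most \<open>2 \<surd>(2 / \<tau>)\<close>, which is of the order of \<open>1 / \<surd>(cond k)\<close>. The constant
  comes from \<open>m \<ge> n / 5\<close> and from \<open>cond k - 1 \<ge> (1 - \<mu> / L) cond k\<close>.
\<close>

lemma rounds_lower_bound:
  assumes acc: "reaches_accuracy n f A (\<lambda>_. b) E xopt \<epsilon> rs x" and x: "ell2_coord (x m) k = 0"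
    and N: "k div 2 \<le> N + 2" and \<epsilon>: "0 < \<epsilon>"
  shows "sqrt ((1 - 1 / (L / \<mu>)) / 10) / 2 * (sqrt (cond k) * ln (C / \<epsilon>)) \<le> real N"
proof (cases "0 \<le> ln (C / \<epsilon>)")
  case False
  have "0 \<le> sqrt ((1 - 1 / (L / \<mu>)) / 10) / 2 * sqrt (cond k)" using cond_gt(3)[of k] cond_gt(4) by (intro mult_nonneg_nonneg) auto
  then have "sqrt ((1 - 1 / (L / \<mu>)) / 10) / 2 * sqrt (cond k) * ln (C / \<epsilon>) \<le> 0"
    using False by (intro mult_nonneg_nonpos) auto
  then show ?thesis by (simp add: mult.assoc)
next
  case True
  define q where "q = decay (\<tau> k)"
  have q: "0 < q" "q < 1" using decay_\<tau> by (auto simp: q_def)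
  have "min (decay (\<tau> 0)) (decay (\<tau> 1)) \<le> q"
    using \<tau>_parity[of k 0] \<tau>_parity[of k 1] by (cases "even k") (auto simp: q_def min_def)
  then have "C \<le> (q\<^sup>2 / L)\<^sup>2"
    unfolding C_def using L_pos decay_\<tau>(1) by (intro power_mono divide_right_mono) (auto simp: min_def intro: less_imp_le)
  then have "C * q ^ (2 * N) \<le> (q\<^sup>2 / L)\<^sup>2 * q ^ (2 * N)" using q by (intro mult_right_mono) auto
  also have "\<dots> = (q ^ (N + 2) / L)\<^sup>2"
  proof -
    have "q ^ (2 * N) = (q ^ N)\<^sup>2" by (simp flip: power_mult add: mult.commute)
    then show ?thesis by (simp add: power_add power_mult_distrib power_divide)
  qed
  also have "\<dots> \<le> (q ^ (k div 2) / L)\<^sup>2"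
    using q L_pos N by (intro power_mono divide_right_mono power_decreasing) auto
  also have "\<dots> \<le> \<epsilon>" unfolding q_def by (rule error_lower_bound[OF acc x])
  finally have "C / \<epsilon> \<le> 1 / q ^ (2 * N)" using q \<epsilon> by (simp add: field_simps)
  then have "ln (C / \<epsilon>) \<le> ln (1 / q ^ (2 * N))" using C_pos \<epsilon> q by (intro ln_mono) auto
  also have "\<dots> = 2 * real N * (- ln q)" using q by (simp add: ln_div ln_realpow)
  also have "\<dots> \<le> 2 * real N * sqrt (2 / \<tau> k)"
    unfolding q_def by (intro mult_left_mono decay_\<tau>(4)) auto
  finally have ln_le: "ln (C / \<epsilon>) \<le> 2 * real N * sqrt (2 / \<tau> k)" .
  have "(1 - 1 / (L / \<mu>)) / 10 * cond k \<le> \<tau> k / 2"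
  proof -
    have "(1 - 1 / (L / \<mu>)) * cond k \<le> (1 - 1 / cond k) * cond k"
      using cond_gt(1) cond_gt(2,3)[of k]
      by (intro mult_right_mono diff_left_mono divide_left_mono mult_pos_pos) auto
    also have "\<dots> = cond k - 1" using cond_gt(3)[of k] by (simp add: field_simps)
    finally have "(1 - 1 / (L / \<mu>)) * cond k / 5 \<le> 1 / 5 * (cond k - 1)" by simp
    also have "\<dots> \<le> \<tau> k"
      unfolding \<tau>_def using m_bounds cond_gt(3)[of k]
      by (intro mult_right_mono) (auto simp: field_simps)
    finally show ?thesis by simp
  qed
  then have "sqrt ((1 - 1 / (L / \<mu>)) / 10) * sqrt (cond k) \<le> sqrt (\<tau> k / 2)"
    unfolding real_sqrt_mult[symmetric] by (rule real_sqrt_le_mono)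
  then have "sqrt ((1 - 1 / (L / \<mu>)) / 10) * sqrt (cond k) * ln (C / \<epsilon>) \<le> sqrt (\<tau> k / 2) * (2 * real N * sqrt (2 / \<tau> k))"
    using True ln_le \<tau>_pos[of k] by (intro mult_mono) auto
  also have "\<dots> = 2 * real N * sqrt (\<tau> k / 2 * (2 / \<tau> k))" by (simp only: real_sqrt_mult ac_simps)
  also have "\<dots> = 2 * real N" using \<tau>_pos[of k] by simp
  finally show ?thesis by (simp add: mult.assoc)
qed

end


section \<open>The lower bounds\<close>

text \<open>
  No positive constant can replace the root: for \<open>\<kappa>\<^sub>f\<close> close to \<open>1\<close> the rate \<open>q\<close> of the even chain is close
  to \<open>0\<close>, and a single link gains an arbitrarily large factor in the accuracy.
\<close>

definition hardness_factor :: "real \<Rightarrow> real" where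
  "hardness_factor t = sqrt ((1 - 1 / t) / 10) / 16"

theorem theorem2:
  shows "\<exists>c :: real \<Rightarrow> real. (\<forall>t>1. 0 < c t) \<and> mono_on {1<..} c \<and>
    (\<forall>L\<^sub>f \<mu>\<^sub>f \<kappa>\<^sub>A \<kappa>\<^sub>W :: real. 0 < \<mu>\<^sub>f \<and> \<mu>\<^sub>f < L\<^sub>f \<and> 1 \<le> \<kappa>\<^sub>A \<and> 1 \<le> \<kappa>\<^sub>W \<longrightarrow>
      (\<exists>(n :: nat) (f :: nat \<Rightarrow> ell2 \<Rightarrow> real) (A :: nat \<Rightarrow> ell2 \<Rightarrow> ell2) (b :: nat \<Rightarrow> ell2)
         (L\<^sub>A :: real) (\<mu>\<^sub>A :: real) (E :: (nat \<times> nat) set) (W :: real mat)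
         (xopt :: nat \<Rightarrow> ell2) (C :: real).
        0 < n \<and>
        (\<forall>i<n. smooth_strongly_convex L\<^sub>f \<mu>\<^sub>f (f i)) \<and>
        (\<forall>i<n. bounded_linear (A i)) \<and> constraint_constants n A L\<^sub>A \<mu>\<^sub>A \<and> \<kappa>\<^sub>A = L\<^sub>A / \<mu>\<^sub>A \<and>
        simple_graph n E \<and> gossip_matrix n E W \<and> \<kappa>\<^sub>W = gossip_condition_number W \<and>
        is_solution n f A b xopt \<and> 0 < C \<and>
        (\<forall>\<epsilon>>0. \<forall>rs x. reaches_accuracy n f A b E xopt \<epsilon> rs x \<longrightarrow>
          (let \<kappa>\<^sub>f = L\<^sub>f / \<mu>\<^sub>f in
            real (count_list rs Gradient_Round)
              \<ge> c \<kappa>\<^sub>f * (sqrt \<kappa>\<^sub>f * ln (C / \<epsilon>)) \<and>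
            real (count_list rs Multiplication_Round)
              \<ge> c \<kappa>\<^sub>f * (sqrt \<kappa>\<^sub>f * sqrt \<kappa>\<^sub>A * ln (C / \<epsilon>)) \<and>
            real (count_list rs Communication_Round)
              \<ge> c \<kappa>\<^sub>f * (sqrt \<kappa>\<^sub>f * sqrt \<kappa>\<^sub>A * sqrt \<kappa>\<^sub>W * ln (C / \<epsilon>))))))"
proof (intro exI[of _ hardness_factor] conjI allI impI)
  show "0 < hardness_factor t" if "1 < t" for t using that by (simp add: hardness_factor_def)
  show "mono_on {1<..} hardness_factor"
    by (rule mono_onI) (auto simp: hardness_factor_def field_simps)
  fix L \<mu> \<kappa> \<kappa>W :: real
  assume asm: "0 < \<mu> \<and> \<mu> < L \<and> 1 \<le> \<kappa> \<and> 1 \<le> \<kappa>W"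
  then obtain n E W where n: "3 \<le> n" and W: "simple_graph n E" "gossip_matrix n E W"
    "gossip_condition_number W = \<kappa>W" and E: "\<forall>(i, j)\<in>E. i \<le> j + 2 \<and> j \<le> i + 2"
    and \<kappa>W: "sqrt \<kappa>W \<le> 4 * real n / 3"
    using exists_gossip_matrix[of \<kappa>W] by blast
  interpret hard_instance n E L \<mu> \<kappa>
    using n E asm by unfold_locales auto
  have bounds: "real (count_list rs Gradient_Round)
          \<ge> hardness_factor (L / \<mu>) * (sqrt (L / \<mu>) * ln (C / \<epsilon>)) \<and>
        real (count_list rs Multiplication_Round)
          \<ge> hardness_factor (L / \<mu>) * (sqrt (L / \<mu>) * sqrt \<kappa> * ln (C / \<epsilon>)) \<and>
        real (count_list rs Communication_Round)
          \<ge> hardness_factor (L / \<mu>) * (sqrt (L / \<mu>) * sqrt \<kappa> * sqrt \<kappa>W * ln (C / \<epsilon>))"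
    if \<epsilon>: "0 < \<epsilon>" and acc: "reaches_accuracy n f A (\<lambda>_. b) E xopt \<epsilon> rs x" for \<epsilon> rs x
  proof -
    have xm: "x m \<in> fst (memory_after f A (\<lambda>_. b) E rs) m"
      using acc m_bounds by (simp add: reaches_accuracy_def)
    let ?h = "hardness_factor (L / \<mu>)"
    have h: "sqrt ((1 - 1 / (L / \<mu>)) / 10) / 2 = 8 * ?h" by (simp add: hardness_factor_def)
    have h0: "0 \<le> ?h" using cond_gt(4) by (simp add: hardness_factor_def)
    have weaken: "?h * y \<le> N" if "8 * ?h * y \<le> N" "0 \<le> N" for y N :: real
    proof (cases "0 \<le> y")
      case True
      then have "0 \<le> ?h * y" using h0 by simp
      then show ?thesis using that by simp
    next
      case False
      then have "?h * y \<le> 0" using h0 by (simp add: mult_nonneg_nonpos)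
      then show ?thesis using that by simp
    qed
    have "8 * ?h * (sqrt (L / \<mu>) * ln (C / \<epsilon>)) \<le> real (count_list rs Gradient_Round)"
      using rounds_lower_bound[OF acc gradient_frontier[OF xm] _ \<epsilon>, of "count_list rs Gradient_Round", unfolded h]
      by (simp add: cond_def)
    then have "?h * (sqrt (L / \<mu>) * ln (C / \<epsilon>)) \<le> real (count_list rs Gradient_Round)"
      by (rule weaken) simp
    moreover
    have "8 * ?h * (sqrt (L / \<mu>) * sqrt \<kappa> * ln (C / \<epsilon>)) \<le> real (count_list rs Multiplication_Round)"
      using rounds_lower_bound[OF acc multiplication_frontier[OF xm] _ \<epsilon>, of "count_list rs Multiplication_Round", unfolded h sqrt_cond_odd]
      by simp
    then have "?h * (sqrt (L / \<mu>) * sqrt \<kappa> * ln (C / \<epsilon>)) \<le> real (count_list rs Multiplication_Round)"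
      by (rule weaken) simp
    moreover
    have "?h * (sqrt (L / \<mu>) * sqrt \<kappa> * sqrt \<kappa>W * ln (C / \<epsilon>)) \<le> real (count_list rs Communication_Round)"
    proof -
      let ?N = "count_list rs Communication_Round"
      define y where "y = ?h * (sqrt (L / \<mu>) * sqrt \<kappa> * ln (C / \<epsilon>))"
      have N: "8 * y \<le> real (?N div D)"
        using rounds_lower_bound[OF acc communication_frontier[OF xm] _ \<epsilon>, of "?N div D", unfolded h sqrt_cond_odd]
        by (simp add: y_def mult.assoc)
      \<comment> \<open>each link costs \<open>D\<close> rounds, and \<open>D \<ge> n / 6 \<ge> \<surd>\<kappa>W / 8\<close>\<close>
      have "y * sqrt \<kappa>W \<le> real ?N"
      proof (cases "0 \<le> y")
        case True
        have "sqrt \<kappa>W \<le> 8 * real D" using \<kappa>W D_bounds(2) by linarith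
        then have "y * sqrt \<kappa>W \<le> y * (8 * real D)" using True by (rule mult_left_mono)
        also have "\<dots> = (8 * y) * real D" by simp
        also have "\<dots> \<le> real (?N div D) * real D" using N by (intro mult_right_mono) auto
        also have "\<dots> \<le> real ?N" by (metis of_nat_le_iff of_nat_mult div_times_less_eq_dividend)
        finally show ?thesis .
      next
        case False
        then have "y * sqrt \<kappa>W \<le> 0" using asm by (simp add: mult_nonpos_nonneg)
        then show ?thesis using of_nat_0_le_iff order_trans by blast
      qed
      then show ?thesis by (simp add: y_def ac_simps)
    qed
    ultimately show ?thesis by blast
  qed
  show "\<exists>n f (A :: nat \<Rightarrow> ell2 \<Rightarrow> ell2) b L\<^sub>A \<mu>\<^sub>A E W xopt C. 0 < n \<and>
        (\<forall>i<n. smooth_strongly_convex L \<mu> (f i)) \<and>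
        (\<forall>i<n. bounded_linear (A i)) \<and> constraint_constants n A L\<^sub>A \<mu>\<^sub>A \<and> \<kappa> = L\<^sub>A / \<mu>\<^sub>A \<and>
        simple_graph n E \<and> gossip_matrix n E W \<and> \<kappa>W = gossip_condition_number W \<and>
        is_solution n f A b xopt \<and> 0 < C \<and>
        (\<forall>\<epsilon>>0. \<forall>rs (x :: nat \<Rightarrow> ell2). reaches_accuracy n f A b E xopt \<epsilon> rs x \<longrightarrow>
          (let \<kappa>\<^sub>f = L / \<mu> in
            real (count_list rs Gradient_Round)
              \<ge> hardness_factor \<kappa>\<^sub>f * (sqrt \<kappa>\<^sub>f * ln (C / \<epsilon>)) \<and>
            real (count_list rs Multiplication_Round)
              \<ge> hardness_factor \<kappa>\<^sub>f * (sqrt \<kappa>\<^sub>f * sqrt \<kappa> * ln (C / \<epsilon>)) \<and>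
            real (count_list rs Communication_Round)
              \<ge> hardness_factor \<kappa>\<^sub>f * (sqrt \<kappa>\<^sub>f * sqrt \<kappa> * sqrt \<kappa>W * ln (C / \<epsilon>))))"
    unfolding Let_def
    by (rule exI[of _ n], rule exI[of _ f], rule exI[of _ A], rule exI[of _ "\<lambda>_. b"], rule exI[of _ \<kappa>],
        rule exI[of _ 1], rule exI[of _ E], rule exI[of _ W], rule exI[of _ xopt], rule exI[of _ C],
        intro conjI allI impI)
       (use n W smooth_strongly_convex_f bounded_linear_ops(3) constraint_constants_A is_solution_xopt
          C_pos bounds in simp_all)
qed

end
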